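(* Let $(\Lambda,d)$ be a compactly aligned topological $k$-graph. For every boundary path $x\in\partial\Lambda$, every $m\in\mathbb{N}^k$ with $m\le d(x)$, and every $\lambda\in\Lambda$ with $s(\lambda)=r(x)$, we have $\sigma^mx\in\partial\Lambda$ and $\lambda x\in\partial\Lambda$. Hence $\partial\Lambda$ is an invariant subset of the unit space $G_\Lambda^{(0)}=X_\Lambda$ of the path groupoid $G_\Lambda$.
   Context: Conventions: $\mathbb{N}=\{0,1,2,\dots\}$; on $(\mathbb{N}\cup\{\infty\})^k$, $\le$ is the coordinatewise order and $\vee,\wedge$ are coordinatewise max and min. Topological $k$-graph ($k\in\mathbb{N}$): a pair $(\Lambda,d)$ of a small category $\Lambda$ (range = codomain map $r$, source = domain map $s$; $\lambda\mu$ is defined when $s(\lambda)=r(\mu)$) and a functor $d:\Lambda\to\mathbb{N}^k$ such that: (1) the object and morphism sets are second-countable locally compact Hausdorff spaces; (2) $r,s$ are continuous and $s$ is a local homeomorphism; (3) composition, from the set of composable pairs with the relative product topology, is continuous and open; (4) $d$ is continuous, $\mathbb{N}^k$ being discrete; (5) if $d(\lambda)=m+n$ there is a unique composable pair $(\xi,\eta)$ with $\lambda=\xi\eta$, $d(\xi)=m$, $d(\eta)=n$. $\Lambda$ also denotes the morphism set, objects are identified with identity morphisms, $\Lambda^m:=d^{-1}(\{m\})$ (so $\Lambda^0$ is the object set), and $UV:=\{\lambda\mu:\lambda\in U,\mu\in V,s(\lambda)=r(\mu)\}$ for $U,V\subset\Lambda$. Compactly aligned: for all $p,q\in\mathbb{N}^k$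 and compact $U\subset\Lambda^p$, $V\subset\Lambda^q$, the set $U\Lambda^{(p\vee q)-p}\cap V\Lambda^{(p\vee q)-q}$ is compact. Path space: for $m\in(\mathbb{N}\cup\{\infty\})^k$ let $\Omega_{k,m}$ be the discrete topological $k$-graph with objects $\{p\in\mathbb{N}^k:p\le m\}$, morphisms $\{(p,q)\in\mathbb{N}^k\times\mathbb{N}^k:p\le q\le m\}$, $r(p,q)=p$, $s(p,q)=q$, $(n,p)(p,q)=(n,q)$, $d(p,q)=q-p$. $X_\Lambda$ is the set of all degree-preserving (continuous) functors $x:\Omega_{k,m}\to\Lambda$, $m\in(\mathbb{N}\cup\{\infty\})^k$; put $d(x)=m$, $r(x)=x(0)$. For $m\in\mathbb{N}^k$, $m\le d(x)$, $\sigma^mx\in X_\Lambda$ has degree $d(x)-m$ and $(\sigma^mx)(0,p)=x(m,m+p)$; for $\lambda\in\Lambda$ with $s(\lambda)=r(x)$, $\lambda x\in X_\Lambda$ has degree $d(\lambda)+d(x)$, $(\lambda x)(0,d(\lambda))=\lambda$ and $\sigma^{d(\lambda)}(\lambda x)=x$. The path groupoid $G_\Lambda$ has object set $X_\Lambda$ and morphisms $(\lambda x,d(\lambda)-d(\mu),\mu x)\in X_\Lambda\times\mathbb{Z}^k\times X_\Lambda$ with $\lambda,\mu\in\Lambda$, $x\in X_\Lambda$, $s(\lambda)=s(\mu)=r(x)$; $r(x,m,y)=x$, $s(x,m,y)=y$, $(x,m,y)(y,n,z)=(x,m+n,z)$, $(x,m,y)^{-1}=(y,-m,x)$. A subset $Y$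 of the unit space is invariant if for every morphism $\gamma$, $s(\gamma)\in Y$ iff $r(\gamma)\in Y$. Boundary paths: $\Lambda^{\min}(\lambda,\mu):=\{(\alpha,\beta):\lambda\alpha=\mu\beta,\ d(\lambda\alpha)=d(\lambda)\vee d(\mu)\}$. For $V\subset\Lambda^0$, a set $E\subset V\Lambda$ is exhaustive for $V$ if for every $\lambda\in V\Lambda$ there is $\mu\in E$ with $\Lambda^{\min}(\lambda,\mu)\neq\emptyset$. For $v\in\Lambda^0$, $v\mathcal{CE}(\Lambda)$ is the set of compact $E\subset\Lambda$ such that $r(E)$ is a neighbourhood of $v$ and $E$ is exhaustive for $r(E)$. $x\in X_\Lambda$ is a boundary path if for all $m\in\mathbb{N}^k$ with $m\le d(x)$ and all $E\in x(m)\mathcal{CE}(\Lambda)$ there is $\lambda\in E$ with $x(m,m+d(\lambda))=\lambda$. $\partial\Lambda$ is the set of boundary paths. *)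

theory Defs
  imports
    "HOL-Analysis.Analysis"
    "HOL-Library.Extended_Nat"
    "HOL-Library.Function_Algebras"
begin

subsection \<open>Multi-indices\<close>

text \<open>
  A \<open>k\<close>-tuple is a function on \<^typ>\<open>nat\<close> that vanishes at every index \<open>i \<ge> k\<close>; this covers all
  \<open>k\<close>, including \<open>k = 0\<close>.  The pointwise operations and orders on functions (\<open>+\<close>, \<open>-\<close>, \<open>\<le>\<close>, \<open>sup\<close>)
  are then the coordinatewise ones.
\<close>

definition Nk :: "nat \<Rightarrow> (nat \<Rightarrow> nat) set" where
  "Nk k = {m. \<forall>i\<ge>k. m i = 0}"

definition Nk_inf :: "nat \<Rightarrow> (nat \<Rightarrow> enat) set" where
  "Nk_inf k = {m. \<forall>i\<ge>k. m i = 0}"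

definition emb :: "(nat \<Rightarrow> nat) \<Rightarrow> nat \<Rightarrow> enat" where
  "emb m = (\<lambda>i. enat (m i))"

subsection \<open>Small categories\<close>

text \<open>Composition is written as in \<open>\<lambda>\<mu>\<close>: it is meaningful if the source of the first factor is the
  range of the second.\<close>

record ('o, 'a) category =
  ob :: "'o set"
  mor :: "'a set"
  rng :: "'a \<Rightarrow> 'o"
  src :: "'a \<Rightarrow> 'o"
  ident :: "'o \<Rightarrow> 'a"
  cmp :: "'a \<Rightarrow> 'a \<Rightarrow> 'a"

definition composable :: "('o, 'a, 'z) category_scheme \<Rightarrow> ('a \<times> 'a) set" where
  "composable C = {(f, g). f \<in> mor C \<and> g \<in> mor C \<and> src C f = rng C g}"

definition small_category :: "('o, 'a, 'z) category_scheme \<Rightarrow> bool" where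
  "small_category C \<longleftrightarrow>
     rng C ` mor C \<subseteq> ob C \<and> src C ` mor C \<subseteq> ob C \<and> ident C ` ob C \<subseteq> mor C \<and>
     (\<forall>v\<in>ob C. rng C (ident C v) = v \<and> src C (ident C v) = v) \<and>
     (\<forall>(f, g)\<in>composable C.
        cmp C f g \<in> mor C \<and> rng C (cmp C f g) = rng C f \<and> src C (cmp C f g) = src C g) \<and>
     (\<forall>f\<in>mor C. cmp C (ident C (rng C f)) f = f \<and> cmp C f (ident C (src C f)) = f) \<and>
     (\<forall>f g h. (f, g) \<in> composable C \<and> (g, h) \<in> composable C \<longrightarrow>
        cmp C (cmp C f g) h = cmp C f (cmp C g h))"

subsection \<open>Topological \<open>k\<close>-graphs\<close>

definition second_countable_space :: "'a topology \<Rightarrow> bool" where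
  "second_countable_space X \<longleftrightarrow>
     (\<exists>B. countable B \<and> (\<forall>V\<in>B. openin X V) \<and>
          (\<forall>U x. openin X U \<and> x \<in> U \<longrightarrow> (\<exists>V\<in>B. x \<in> V \<and> V \<subseteq> U)))"

definition local_homeomorphism_map :: "'a topology \<Rightarrow> 'b topology \<Rightarrow> ('a \<Rightarrow> 'b) \<Rightarrow> bool" where
  "local_homeomorphism_map X Y f \<longleftrightarrow>
     f ` topspace X \<subseteq> topspace Y \<and>
     (\<forall>x\<in>topspace X. \<exists>U. openin X U \<and> x \<in> U \<and> openin Y (f ` U) \<and>
        homeomorphic_map (subtopology X U) (subtopology Y (f ` U)) f)"

record ('o, 'a) kgraph = "('o, 'a) category" +
  ob_top :: "'o topology"
  mor_top :: "'a topology"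
  deg :: "'a \<Rightarrow> nat \<Rightarrow> nat"

definition topological_kgraph :: "nat \<Rightarrow> ('o, 'a) kgraph \<Rightarrow> bool" where
  "topological_kgraph k \<Lambda> \<longleftrightarrow>
     small_category \<Lambda> \<and>
     \<comment> \<open>\<open>d\<close> is a functor to the monoid \<open>\<nat>\<^sup>k\<close>\<close>
     deg \<Lambda> ` mor \<Lambda> \<subseteq> Nk k \<and>
     (\<forall>v\<in>ob \<Lambda>. deg \<Lambda> (ident \<Lambda> v) = 0) \<and>
     (\<forall>(f, g)\<in>composable \<Lambda>. deg \<Lambda> (cmp \<Lambda> f g) = deg \<Lambda> f + deg \<Lambda> g) \<and>
     topspace (ob_top \<Lambda>) = ob \<Lambda> \<and> topspace (mor_top \<Lambda>) = mor \<Lambda> \<and>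
     second_countable_space (ob_top \<Lambda>) \<and> locally_compact_space (ob_top \<Lambda>) \<and>
     Hausdorff_space (ob_top \<Lambda>) \<and>
     second_countable_space (mor_top \<Lambda>) \<and> locally_compact_space (mor_top \<Lambda>) \<and>
     Hausdorff_space (mor_top \<Lambda>) \<and>
     continuous_map (mor_top \<Lambda>) (ob_top \<Lambda>) (rng \<Lambda>) \<and>
     continuous_map (mor_top \<Lambda>) (ob_top \<Lambda>) (src \<Lambda>) \<and>
     local_homeomorphism_map (mor_top \<Lambda>) (ob_top \<Lambda>) (src \<Lambda>) \<and>
     continuous_map (subtopology (prod_topology (mor_top \<Lambda>) (mor_top \<Lambda>)) (composable \<Lambda>))
       (mor_top \<Lambda>) (\<lambda>(f, g). cmp \<Lambda> f g) \<and>
     open_map (subtopology (prod_topology (mor_top \<Lambda>) (mor_top \<Lambda>)) (composable \<Lambda>))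
       (mor_top \<Lambda>) (\<lambda>(f, g). cmp \<Lambda> f g) \<and>
     continuous_map (mor_top \<Lambda>) (discrete_topology (Nk k)) (deg \<Lambda>) \<and>
     (\<forall>f\<in>mor \<Lambda>. \<forall>m\<in>Nk k. \<forall>n\<in>Nk k. deg \<Lambda> f = m + n \<longrightarrow>
        (\<exists>!(g, h). (g, h) \<in> composable \<Lambda> \<and> cmp \<Lambda> g h = f \<and> deg \<Lambda> g = m \<and> deg \<Lambda> h = n))"

text \<open>\<open>\<Lambda>\<^sup>m\<close>\<close>
definition of_degree :: "('o, 'a) kgraph \<Rightarrow> (nat \<Rightarrow> nat) \<Rightarrow> 'a set" where
  "of_degree \<Lambda> m = {f \<in> mor \<Lambda>. deg \<Lambda> f = m}"

text \<open>\<open>UV\<close>\<close>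
definition set_cmp :: "('o, 'a) kgraph \<Rightarrow> 'a set \<Rightarrow> 'a set \<Rightarrow> 'a set" where
  "set_cmp \<Lambda> U V = {cmp \<Lambda> f g | f g. f \<in> U \<and> g \<in> V \<and> src \<Lambda> f = rng \<Lambda> g}"

text \<open>\<open>V\<Lambda>\<close> for a set \<open>V\<close> of objects, each object being identified with its identity morphism.\<close>
definition paths_with_range :: "('o, 'a) kgraph \<Rightarrow> 'o set \<Rightarrow> 'a set" where
  "paths_with_range \<Lambda> V = set_cmp \<Lambda> (ident \<Lambda> ` V) (mor \<Lambda>)"

definition compactly_aligned :: "nat \<Rightarrow> ('o, 'a) kgraph \<Rightarrow> bool" where
  "compactly_aligned k \<Lambda> \<longleftrightarrow>
     (\<forall>p\<in>Nk k. \<forall>q\<in>Nk k. \<forall>U V.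
        compactin (mor_top \<Lambda>) U \<and> U \<subseteq> of_degree \<Lambda> p \<and>
        compactin (mor_top \<Lambda>) V \<and> V \<subseteq> of_degree \<Lambda> q \<longrightarrow>
        compactin (mor_top \<Lambda>)
          (set_cmp \<Lambda> U (of_degree \<Lambda> (sup p q - p)) \<inter> set_cmp \<Lambda> V (of_degree \<Lambda> (sup p q - q))))"

subsection \<open>The path space\<close>

definition Omega :: "nat \<Rightarrow> (nat \<Rightarrow> enat) \<Rightarrow> (nat \<Rightarrow> nat, (nat \<Rightarrow> nat) \<times> (nat \<Rightarrow> nat)) kgraph" where
  "Omega k m = (let
      Obs = {p \<in> Nk k. emb p \<le> m};
      Mrs = {(p, q). p \<in> Nk k \<and> q \<in> Nk k \<and> p \<le> q \<and> emb q \<le> m}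
    in \<lparr>ob = Obs, mor = Mrs, rng = fst, src = snd, ident = (\<lambda>p. (p, p)),
        cmp = (\<lambda>f g. (fst f, snd g)),
        ob_top = discrete_topology Obs, mor_top = discrete_topology Mrs,
        deg = (\<lambda>(p, q). q - p)\<rparr>)"

text \<open>Continuous degree-preserving functors, given by their object and morphism maps.\<close>
definition kgraph_morphism ::
    "('o, 'a) kgraph \<Rightarrow> ('p, 'b) kgraph \<Rightarrow> ('o \<Rightarrow> 'p) \<Rightarrow> ('a \<Rightarrow> 'b) \<Rightarrow> bool" where
  "kgraph_morphism \<Lambda> \<Gamma> F0 F \<longleftrightarrow>
     F0 ` ob \<Lambda> \<subseteq> ob \<Gamma> \<and> F ` mor \<Lambda> \<subseteq> mor \<Gamma> \<and>
     (\<forall>f\<in>mor \<Lambda>. rng \<Gamma> (F f) = F0 (rng \<Lambda> f) \<and> src \<Gamma> (F f) = F0 (src \<Lambda> f)) \<and>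
     (\<forall>v\<in>ob \<Lambda>. F (ident \<Lambda> v) = ident \<Gamma> (F0 v)) \<and>
     (\<forall>(f, g)\<in>composable \<Lambda>. F (cmp \<Lambda> f g) = cmp \<Gamma> (F f) (F g)) \<and>
     (\<forall>f\<in>mor \<Lambda>. deg \<Gamma> (F f) = deg \<Lambda> f) \<and>
     continuous_map (ob_top \<Lambda>) (ob_top \<Gamma>) F0 \<and> continuous_map (mor_top \<Lambda>) (mor_top \<Gamma>) F"

text \<open>A path is stored with its degree, and its two maps are required to be extensional (that is,
  \<^const>\<open>undefined\<close> off their domains), so that equality of records is equality of functors.\<close>
record ('o, 'a) path =
  pdeg :: "nat \<Rightarrow> enat"
  pobj :: "(nat \<Rightarrow> nat) \<Rightarrow> 'o"
  pmor :: "(nat \<Rightarrow> nat) \<times> (nat \<Rightarrow> nat) \<Rightarrow> 'a"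

definition path_space :: "nat \<Rightarrow> ('o, 'a) kgraph \<Rightarrow> ('o, 'a) path set" where
  "path_space k \<Lambda> = {x. pdeg x \<in> Nk_inf k \<and>
     pobj x \<in> extensional (ob (Omega k (pdeg x))) \<and>
     pmor x \<in> extensional (mor (Omega k (pdeg x))) \<and>
     kgraph_morphism (Omega k (pdeg x)) \<Lambda> (pobj x) (pmor x)}"

definition prange :: "('o, 'a) path \<Rightarrow> 'o" where
  "prange x = pobj x 0"

text \<open>\<open>\<sigma>\<^sup>m x\<close>, for \<open>m \<le> d(x)\<close>\<close>
definition shift :: "nat \<Rightarrow> (nat \<Rightarrow> nat) \<Rightarrow> ('o, 'a) path \<Rightarrow> ('o, 'a) path" where
  "shift k m x = (let n = pdeg x - emb m in
     \<lparr>pdeg = n,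
      pobj = restrict (\<lambda>p. pobj x (m + p)) (ob (Omega k n)),
      pmor = restrict (\<lambda>(p, q). pmor x (m + p, m + q)) (mor (Omega k n))\<rparr>)"

text \<open>\<open>\<lambda>x\<close>, for \<open>s(\<lambda>) = r(x)\<close>; existence and uniqueness follow from the factorization property.\<close>
definition prepend :: "nat \<Rightarrow> ('o, 'a) kgraph \<Rightarrow> 'a \<Rightarrow> ('o, 'a) path \<Rightarrow> ('o, 'a) path" where
  "prepend k \<Lambda> f x = (THE y. y \<in> path_space k \<Lambda> \<and> pdeg y = emb (deg \<Lambda> f) + pdeg x \<and>
     pmor y (0, deg \<Lambda> f) = f \<and> shift k (deg \<Lambda> f) y = x)"

subsection \<open>The path groupoid\<close>

record ('o, 'g) groupoid = "('o, 'g) category" +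
  ginv :: "'g \<Rightarrow> 'g"

definition path_groupoid :: "nat \<Rightarrow> ('o, 'a) kgraph \<Rightarrow>
    (('o, 'a) path, ('o, 'a) path \<times> (nat \<Rightarrow> int) \<times> ('o, 'a) path) groupoid" where
  "path_groupoid k \<Lambda> =
     \<lparr>ob = path_space k \<Lambda>,
      mor = {(prepend k \<Lambda> f x, (\<lambda>i. int (deg \<Lambda> f i) - int (deg \<Lambda> g i)), prepend k \<Lambda> g x) | f g x.
               f \<in> mor \<Lambda> \<and> g \<in> mor \<Lambda> \<and> x \<in> path_space k \<Lambda> \<and>
               src \<Lambda> f = prange x \<and> src \<Lambda> g = prange x},
      rng = (\<lambda>(x, m, y). x), src = (\<lambda>(x, m, y). y), ident = (\<lambda>x. (x, 0, x)),
      cmp = (\<lambda>(x, m, y) (y', n, z). (x, m + n, z)),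
      ginv = (\<lambda>(x, m, y). (y, - m, x))\<rparr>"

definition invariant_subset :: "('o, 'g) groupoid \<Rightarrow> 'o set \<Rightarrow> bool" where
  "invariant_subset G Y \<longleftrightarrow> Y \<subseteq> ob G \<and> (\<forall>\<gamma>\<in>mor G. src G \<gamma> \<in> Y \<longleftrightarrow> rng G \<gamma> \<in> Y)"

subsection \<open>Boundary paths\<close>

definition min_ext :: "('o, 'a) kgraph \<Rightarrow> 'a \<Rightarrow> 'a \<Rightarrow> ('a \<times> 'a) set" where
  "min_ext \<Lambda> f g = {(a, b). (f, a) \<in> composable \<Lambda> \<and> (g, b) \<in> composable \<Lambda> \<and>
     cmp \<Lambda> f a = cmp \<Lambda> g b \<and> deg \<Lambda> (cmp \<Lambda> f a) = sup (deg \<Lambda> f) (deg \<Lambda> g)}"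

definition exhaustive :: "('o, 'a) kgraph \<Rightarrow> 'o set \<Rightarrow> 'a set \<Rightarrow> bool" where
  "exhaustive \<Lambda> V E \<longleftrightarrow> V \<subseteq> ob \<Lambda> \<and> E \<subseteq> paths_with_range \<Lambda> V \<and>
     (\<forall>f\<in>paths_with_range \<Lambda> V. \<exists>g\<in>E. min_ext \<Lambda> f g \<noteq> {})"

definition CE :: "('o, 'a) kgraph \<Rightarrow> 'o \<Rightarrow> 'a set set" where
  "CE \<Lambda> v = {E. compactin (mor_top \<Lambda>) E \<and>
     (\<exists>U. openin (ob_top \<Lambda>) U \<and> v \<in> U \<and> U \<subseteq> rng \<Lambda> ` E) \<and>
     exhaustive \<Lambda> (rng \<Lambda> ` E) E}"

text \<open>Writing \<open>x(m, m + d(\<lambda>))\<close> presupposes \<open>m + d(\<lambda>) \<le> d(x)\<close>.\<close>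
definition boundary_paths :: "nat \<Rightarrow> ('o, 'a) kgraph \<Rightarrow> ('o, 'a) path set" where
  "boundary_paths k \<Lambda> = {x \<in> path_space k \<Lambda>.
     \<forall>m\<in>Nk k. emb m \<le> pdeg x \<longrightarrow>
       (\<forall>E\<in>CE \<Lambda> (pobj x m). \<exists>f\<in>E. emb (m + deg \<Lambda> f) \<le> pdeg x \<and> pmor x (m, m + deg \<Lambda> f) = f)}"

end

theory Submission
  imports Defs
begin

text \<open>
  A path \<open>y\<close> is a boundary path iff \<open>\<sigma>\<^sup>dy\<close> is one for some (any) \<open>d \<le> d(y)\<close>, and \<open>x = \<sigma>\<^sup>d(\<lambda>x)\<close> for \<open>d = d(\<lambda>)\<close>.
  For the nontrivial direction let \<open>E \<in> y(n)\<C>\<E>(\<Lambda>)\<close>, \<open>p = n \<or> d\<close> and \<open>\<mu> = y(n, p)\<close>.  If \<open>U\<close> is a small compact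
  neighbourhood of \<open>\<mu>\<close>, the set \<open>F\<close> of all \<open>\<alpha>\<close> with \<open>(\<alpha>, \<beta>) \<in> \<Lambda>\<^sup>m\<^sup>i\<^sup>n(\<xi>, g)\<close> for some \<open>\<xi> \<in> U\<close>, \<open>g \<in> E\<close> and \<open>\<beta>\<close>
  belongs to \<open>s(\<mu>)\<C>\<E>(\<Lambda>)\<close>; compactness is where compact alignment enters.  The path \<open>\<sigma>\<^sup>dy\<close> passes through
  some \<open>\<alpha> \<in> F\<close> at \<open>p - d\<close>, so \<open>y(n, p + d(\<alpha>)) = \<mu>\<alpha> = g\<beta>\<close> and \<open>y\<close> passes through \<open>g\<close> at \<open>n\<close>.
\<close>

subsection \<open>Arithmetic of multi-indices\<close>

lemma emb_le_sup:
  assumes "emb p \<le> M" "emb q \<le> M"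
  shows "emb (sup p q) \<le> M"
proof (rule le_funI)
  fix i
  show "emb (sup p q) i \<le> M i"
    using le_funD[OF assms(1), of i] le_funD[OF assms(2), of i]
    by (cases "M i") (auto simp: emb_def)
qed

lemma emb_le_trans: "p \<le> q \<Longrightarrow> emb q \<le> M \<Longrightarrow> emb p \<le> M"
  by (auto simp: le_fun_def emb_def intro: order_trans[OF enat_ord_simps(1)[THEN iffD2]])

lemma emb_zero_le [simp]: "emb 0 \<le> M"
  by (simp add: emb_def le_fun_def flip: zero_enat_def)

text \<open>Translates degree bounds between a path and its shift. As \<open>d\<close> is finite,
  adding \<open>d i\<close> can be cancelled in each coordinate; where \<open>M i\<close> is
  infinite, both sides hold trivially.\<close>

lemma emb_add_le_iff:
  assumes "emb d \<le> M"
  shows "emb (d + q) \<le> M \<longleftrightarrow> emb q \<le> M - emb d"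
proof -
  have "enat (d i) + enat (q i) \<le> M i \<longleftrightarrow> enat (q i) \<le> M i - enat (d i)" for i
    using le_funD[OF assms, of i] by (cases "M i") (auto simp: emb_def)
  then show ?thesis by (simp add: le_fun_def emb_def)
qed

lemma fun_add_diff: "p \<le> q \<Longrightarrow> p + (q - p) = (q :: nat \<Rightarrow> nat)"
  by (auto simp: le_fun_def fun_eq_iff)

lemma fun_add_diff_left [simp]: "p + q - p = (q :: nat \<Rightarrow> nat)"
  by (auto simp: fun_eq_iff)

lemma fun_add_diff_cancel [simp]: "(m + p) - (m + q) = (p - q :: nat \<Rightarrow> nat)"
  by (auto simp: fun_eq_iff)

lemma fun_add_le_cancel [simp]: "m + p \<le> m + q \<longleftrightarrow> p \<le> (q :: nat \<Rightarrow> nat)"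
  by (auto simp: le_fun_def)

lemma fun_le_add [simp]: "p \<le> p + (q :: nat \<Rightarrow> nat)"
  by (auto simp: le_fun_def)

lemma fun_zero_le [simp]: "0 \<le> (q :: nat \<Rightarrow> nat)"
  by (auto simp: le_fun_def)

lemma fun_diff_zero [simp]: "q - 0 = (q :: nat \<Rightarrow> nat)"
  by (auto simp: fun_eq_iff)

text \<open>In coordinates with \<open>q i \<le> d i\<close> the truncated difference is 0; in the
  others it is \<open>q i - d i\<close>, where the hypothesis applies.\<close>

lemma emb_sup_diff_le:
  assumes "emb q \<le> emb d + M"
  shows "emb (sup q d - d) \<le> M"
proof (rule le_funI)
  fix i show "emb (sup q d - d) i \<le> M i"
    using le_funD[OF assms, of i] by (cases "M i") (auto simp: emb_def sup_nat_def)
qed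

lemma emb_add_diff [simp]: "emb d + M - emb d = M"
  by (simp add: emb_def fun_eq_iff)

lemma emb_le_add [simp]: "emb d \<le> emb d + M"
  by (simp add: le_fun_def)

lemma Nk_zero [simp]: "0 \<in> Nk k"
  and Nk_add [simp]: "p \<in> Nk k \<Longrightarrow> q \<in> Nk k \<Longrightarrow> p + q \<in> Nk k"
  and Nk_diff [simp]: "p \<in> Nk k \<Longrightarrow> p - q \<in> Nk k"
  and Nk_sup [simp]: "p \<in> Nk k \<Longrightarrow> q \<in> Nk k \<Longrightarrow> sup p q \<in> Nk k"
  by (auto simp: Nk_def)

subsection \<open>Factorization and prefixes\<close>

locale top_kgraph =
  fixes k :: nat and \<Lambda> :: "('o, 'a) kgraph"
  assumes top_kgraph: "topological_kgraph k \<Lambda>"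
begin

lemma cat: "small_category \<Lambda>"
  and deg_image: "deg \<Lambda> ` mor \<Lambda> \<subseteq> Nk k"
  and deg_ident_ball: "\<forall>v\<in>ob \<Lambda>. deg \<Lambda> (ident \<Lambda> v) = 0"
  and deg_cmp_ball: "\<forall>(f, g)\<in>composable \<Lambda>. deg \<Lambda> (cmp \<Lambda> f g) = deg \<Lambda> f + deg \<Lambda> g"
  and topspace_ob: "topspace (ob_top \<Lambda>) = ob \<Lambda>"
  and topspace_mor: "topspace (mor_top \<Lambda>) = mor \<Lambda>"
  and locally_compact_mor: "locally_compact_space (mor_top \<Lambda>)"
  and Hausdorff_mor: "Hausdorff_space (mor_top \<Lambda>)"
  and continuous_rng: "continuous_map (mor_top \<Lambda>) (ob_top \<Lambda>) (rng \<Lambda>)"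
  and local_homeo_src: "local_homeomorphism_map (mor_top \<Lambda>) (ob_top \<Lambda>) (src \<Lambda>)"
  and continuous_cmp:
    "continuous_map (subtopology (prod_topology (mor_top \<Lambda>) (mor_top \<Lambda>)) (composable \<Lambda>))
       (mor_top \<Lambda>) (\<lambda>(f, g). cmp \<Lambda> f g)"
  and open_cmp:
    "open_map (subtopology (prod_topology (mor_top \<Lambda>) (mor_top \<Lambda>)) (composable \<Lambda>))
       (mor_top \<Lambda>) (\<lambda>(f, g). cmp \<Lambda> f g)"
  and continuous_deg: "continuous_map (mor_top \<Lambda>) (discrete_topology (Nk k)) (deg \<Lambda>)"
  and factorization_property:
    "\<forall>f\<in>mor \<Lambda>. \<forall>m\<in>Nk k. \<forall>n\<in>Nk k. deg \<Lambda> f = m + n \<longrightarrow>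
        (\<exists>!(g, h). (g, h) \<in> composable \<Lambda> \<and> cmp \<Lambda> g h = f \<and> deg \<Lambda> g = m \<and> deg \<Lambda> h = n)"
  using top_kgraph unfolding topological_kgraph_def by - (elim conjE, assumption)+

section \<open>Elementary consequences of the axioms\<close>

lemma rng_ob [simp]: "f \<in> mor \<Lambda> \<Longrightarrow> rng \<Lambda> f \<in> ob \<Lambda>"
  and src_ob [simp]: "f \<in> mor \<Lambda> \<Longrightarrow> src \<Lambda> f \<in> ob \<Lambda>"
  and ident_mor [simp]: "v \<in> ob \<Lambda> \<Longrightarrow> ident \<Lambda> v \<in> mor \<Lambda>"
  and rng_ident [simp]: "v \<in> ob \<Lambda> \<Longrightarrow> rng \<Lambda> (ident \<Lambda> v) = v"
  and src_ident [simp]: "v \<in> ob \<Lambda> \<Longrightarrow> src \<Lambda> (ident \<Lambda> v) = v"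
  and ident_cmp [simp]: "f \<in> mor \<Lambda> \<Longrightarrow> cmp \<Lambda> (ident \<Lambda> (rng \<Lambda> f)) f = f"
  and cmp_ident [simp]: "f \<in> mor \<Lambda> \<Longrightarrow> cmp \<Lambda> f (ident \<Lambda> (src \<Lambda> f)) = f"
  using cat unfolding small_category_def image_subset_iff by blast+

lemma composableD:
  assumes "(f, g) \<in> composable \<Lambda>"
  shows "f \<in> mor \<Lambda>" "g \<in> mor \<Lambda>" "src \<Lambda> f = rng \<Lambda> g"
  using assms by (auto simp: composable_def)

lemma cmp_props:
  assumes "(f, g) \<in> composable \<Lambda>"
  shows cmp_mor: "cmp \<Lambda> f g \<in> mor \<Lambda>"
    and rng_cmp: "rng \<Lambda> (cmp \<Lambda> f g) = rng \<Lambda> f"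
    and src_cmp: "src \<Lambda> (cmp \<Lambda> f g) = src \<Lambda> g"
    and deg_cmp: "deg \<Lambda> (cmp \<Lambda> f g) = deg \<Lambda> f + deg \<Lambda> g"
proof -
  have "\<forall>(f, g)\<in>composable \<Lambda>.
      cmp \<Lambda> f g \<in> mor \<Lambda> \<and> rng \<Lambda> (cmp \<Lambda> f g) = rng \<Lambda> f \<and> src \<Lambda> (cmp \<Lambda> f g) = src \<Lambda> g"
    using cat unfolding small_category_def by (elim conjE)
  from bspec[OF this assms]
  show "cmp \<Lambda> f g \<in> mor \<Lambda>" "rng \<Lambda> (cmp \<Lambda> f g) = rng \<Lambda> f" "src \<Lambda> (cmp \<Lambda> f g) = src \<Lambda> g"
    by simp_all
  from bspec[OF deg_cmp_ball assms] show "deg \<Lambda> (cmp \<Lambda> f g) = deg \<Lambda> f + deg \<Lambda> g"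
    by simp
qed

lemma cmp_assoc:
  "(f, g) \<in> composable \<Lambda> \<Longrightarrow> (g, h) \<in> composable \<Lambda> \<Longrightarrow>
    cmp \<Lambda> (cmp \<Lambda> f g) h = cmp \<Lambda> f (cmp \<Lambda> g h)"
  using cat unfolding small_category_def by blast

lemma deg_ident [simp]: "v \<in> ob \<Lambda> \<Longrightarrow> deg \<Lambda> (ident \<Lambda> v) = 0"
  and deg_Nk [simp]: "f \<in> mor \<Lambda> \<Longrightarrow> deg \<Lambda> f \<in> Nk k"
  using deg_ident_ball deg_image by blast+

lemma factorization_exists:
  assumes "f \<in> mor \<Lambda>" "m \<in> Nk k" "m \<le> deg \<Lambda> f"
  obtains g h where "(g, h) \<in> composable \<Lambda>" "cmp \<Lambda> g h = f" "deg \<Lambda> g = m" "deg \<Lambda> h = deg \<Lambda> f - m"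
proof -
  have "\<exists>!(g, h). (g, h) \<in> composable \<Lambda> \<and> cmp \<Lambda> g h = f \<and> deg \<Lambda> g = m \<and> deg \<Lambda> h = deg \<Lambda> f - m"
    using bspec[OF bspec[OF bspec[OF factorization_property assms(1)] assms(2)] Nk_diff[OF deg_Nk[OF assms(1)]], of m]
      fun_add_diff[OF assms(3)] by simp
  then show thesis using that by blast
qed

text \<open>Cancellation in the degrees makes the second factors agree in degree too, so both pairs
  are the one factorization of the same morphism. With \<open>g = g'\<close> this is left
  cancellation, a frequent use below.\<close>

lemma factorization_unique:
  assumes c: "(g, h) \<in> composable \<Lambda>" "(g', h') \<in> composable \<Lambda>"
    and eq: "cmp \<Lambda> g h = cmp \<Lambda> g' h'" and d: "deg \<Lambda> g = deg \<Lambda> g'"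
  shows "g = g' \<and> h = h'"
proof -
  have d': "deg \<Lambda> h = deg \<Lambda> h'"
    using deg_cmp[OF c(1)] deg_cmp[OF c(2)] eq d by (metis fun_add_diff_left)
  have "\<exists>!(a, b). (a, b) \<in> composable \<Lambda> \<and> cmp \<Lambda> a b = cmp \<Lambda> g h \<and> deg \<Lambda> a = deg \<Lambda> g \<and> deg \<Lambda> b = deg \<Lambda> h"
    using factorization_property cmp_mor[OF c(1)] deg_cmp[OF c(1)] composableD[OF c(1)] deg_Nk by blast
  \<comment> \<open>The pattern-bound unique existence is restated for a single pair
    \<open>z\<close>, so that \<open>ex1E\<close> can compare the two pairs.\<close>
  then have "\<exists>!z. case z of (a, b) \<Rightarrow> (a, b) \<in> composable \<Lambda> \<and> cmp \<Lambda> a b = cmp \<Lambda> g h \<and> deg \<Lambda> a = deg \<Lambda> g \<and> deg \<Lambda> b = deg \<Lambda> h" .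
  then have "(g, h) = (g', h')"
    by (rule ex1E) (use c eq d d' in \<open>metis (mono_tags, lifting) case_prodI\<close>)
  then show ?thesis by simp
qed

text \<open>Composing with the identity at the source and at the range gives two factorizations of
  \<open>f\<close> whose first factors have degree 0.\<close>

lemma deg_zero_ident:
  assumes "f \<in> mor \<Lambda>" "deg \<Lambda> f = 0"
  shows "f = ident \<Lambda> (rng \<Lambda> f)"
  using factorization_unique[of f "ident \<Lambda> (src \<Lambda> f)" "ident \<Lambda> (rng \<Lambda> f)" f] assms
  by (simp add: composable_def)

section \<open>The prefix order on morphisms\<close>

definition prefix_of :: "'a \<Rightarrow> 'a \<Rightarrow> bool" where
  "prefix_of g f \<longleftrightarrow> (\<exists>t. (g, t) \<in> composable \<Lambda> \<and> cmp \<Lambda> g t = f)"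

lemma prefix_ofI: "(g, t) \<in> composable \<Lambda> \<Longrightarrow> cmp \<Lambda> g t = f \<Longrightarrow> prefix_of g f"
  by (auto simp: prefix_of_def)

lemma prefix_of_mor:
  assumes "prefix_of g f"
  shows "g \<in> mor \<Lambda>" "f \<in> mor \<Lambda>" "rng \<Lambda> g = rng \<Lambda> f" "deg \<Lambda> g \<le> deg \<Lambda> f"
  using assms cmp_props unfolding prefix_of_def by (auto dest: composableD)

lemma prefix_of_refl: "f \<in> mor \<Lambda> \<Longrightarrow> prefix_of f f"
  by (rule prefix_ofI[of _ "ident \<Lambda> (src \<Lambda> f)"]) (auto simp: composable_def)

lemma prefix_of_trans:
  assumes "prefix_of g f" "prefix_of f e"
  shows "prefix_of g e"
proof -
  obtain s t where s: "(g, s) \<in> composable \<Lambda>" "cmp \<Lambda> g s = f"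
    and t: "(f, t) \<in> composable \<Lambda>" "cmp \<Lambda> f t = e"
    using assms by (auto simp: prefix_of_def)
  have st: "(s, t) \<in> composable \<Lambda>"
    using s t src_cmp[OF s(1)] by (auto simp: composable_def)
  show ?thesis
  proof (rule prefix_ofI)
    show "(g, cmp \<Lambda> s t) \<in> composable \<Lambda>"
      using cmp_props[OF st] s by (auto simp: composable_def)
    show "cmp \<Lambda> g (cmp \<Lambda> s t) = e"
      using cmp_assoc[OF s(1) st] s t by simp
  qed
qed

lemma prefix_of_exists:
  assumes "f \<in> mor \<Lambda>" "m \<in> Nk k" "m \<le> deg \<Lambda> f"
  shows "\<exists>g. prefix_of g f \<and> deg \<Lambda> g = m"
  using factorization_exists[OF assms] by (metis prefix_ofI)

lemma prefix_of_unique: "prefix_of g f \<Longrightarrow> prefix_of g' f \<Longrightarrow> deg \<Lambda> g = deg \<Lambda> g' \<Longrightarrow> g = g'"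
  unfolding prefix_of_def using factorization_unique by metis

text \<open>Prefixes of a fixed \<open>f\<close> are ordered like their degrees: the prefix of
  \<open>g'\<close> of degree \<open>deg \<Lambda> g\<close> is also a prefix of \<open>f\<close>,
  hence equals \<open>g\<close>.\<close>

lemma prefix_of_comparable:
  assumes "prefix_of g f" "prefix_of g' f" "deg \<Lambda> g \<le> deg \<Lambda> g'"
  shows "prefix_of g g'"
  using prefix_of_exists[of g' "deg \<Lambda> g"] prefix_of_unique prefix_of_trans prefix_of_mor assms
  by (metis deg_Nk)

subsection \<open>Paths, shifts and concatenation\<close>

text \<open>\<open>Omega\<close> carries discrete topologies, so continuity is automatic and only
  the algebraic conditions on a degree-preserving functor remain.\<close>

lemma path_space_iff:
  "x \<in> path_space k \<Lambda> \<longleftrightarrow>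
    pdeg x \<in> Nk_inf k \<and>
    pobj x \<in> extensional {p \<in> Nk k. emb p \<le> pdeg x} \<and>
    pmor x \<in> extensional {(p, q). p \<in> Nk k \<and> q \<in> Nk k \<and> p \<le> q \<and> emb q \<le> pdeg x} \<and>
    (\<forall>p\<in>Nk k. emb p \<le> pdeg x \<longrightarrow>
      pobj x p \<in> ob \<Lambda> \<and> pmor x (p, p) = ident \<Lambda> (pobj x p)) \<and>
    (\<forall>p\<in>Nk k. \<forall>q\<in>Nk k. p \<le> q \<and> emb q \<le> pdeg x \<longrightarrow>
      pmor x (p, q) \<in> mor \<Lambda> \<and> rng \<Lambda> (pmor x (p, q)) = pobj x p \<and>
      src \<Lambda> (pmor x (p, q)) = pobj x q \<and> deg \<Lambda> (pmor x (p, q)) = q - p) \<and>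
    (\<forall>p\<in>Nk k. \<forall>q\<in>Nk k. \<forall>r\<in>Nk k. p \<le> q \<and> q \<le> r \<and> emb r \<le> pdeg x \<longrightarrow>
      pmor x (p, r) = cmp \<Lambda> (pmor x (p, q)) (pmor x (q, r)))"
proof -
  show ?thesis
    unfolding path_space_def kgraph_morphism_def Omega_def Let_def composable_def
    by (simp add: continuous_map_from_discrete_topology topspace_ob topspace_mor image_subset_iff Pi_iff split_beta)
      (safe; (blast intro: emb_le_trans | fastforce intro: emb_le_trans))
qed

lemma path_ob:
  assumes "x \<in> path_space k \<Lambda>" "p \<in> Nk k" "emb p \<le> pdeg x"
  shows "pobj x p \<in> ob \<Lambda>" "pmor x (p, p) = ident \<Lambda> (pobj x p)"
proof -
  have "\<forall>p\<in>Nk k. emb p \<le> pdeg x \<longrightarrow>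
      pobj x p \<in> ob \<Lambda> \<and> pmor x (p, p) = ident \<Lambda> (pobj x p)"
    using assms(1) unfolding path_space_iff by (elim conjE)
  from bspec[OF this assms(2)] assms(3)
  show "pobj x p \<in> ob \<Lambda>" "pmor x (p, p) = ident \<Lambda> (pobj x p)"
    by simp_all
qed

lemma path_mor:
  assumes "x \<in> path_space k \<Lambda>" "p \<in> Nk k" "q \<in> Nk k" "p \<le> q" "emb q \<le> pdeg x"
  shows "pmor x (p, q) \<in> mor \<Lambda>" "rng \<Lambda> (pmor x (p, q)) = pobj x p"
    "src \<Lambda> (pmor x (p, q)) = pobj x q" "deg \<Lambda> (pmor x (p, q)) = q - p"
proof -
  have "\<forall>p\<in>Nk k. \<forall>q\<in>Nk k. p \<le> q \<and> emb q \<le> pdeg x \<longrightarrow>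
      pmor x (p, q) \<in> mor \<Lambda> \<and> rng \<Lambda> (pmor x (p, q)) = pobj x p \<and>
      src \<Lambda> (pmor x (p, q)) = pobj x q \<and> deg \<Lambda> (pmor x (p, q)) = q - p"
    using assms(1) unfolding path_space_iff by (elim conjE)
  from bspec[OF bspec[OF this assms(2)] assms(3)]
  show "pmor x (p, q) \<in> mor \<Lambda>" "rng \<Lambda> (pmor x (p, q)) = pobj x p"
    "src \<Lambda> (pmor x (p, q)) = pobj x q" "deg \<Lambda> (pmor x (p, q)) = q - p"
    using assms(4,5) by simp_all
qed

lemma path_cmp:
  assumes "x \<in> path_space k \<Lambda>" "p \<in> Nk k" "q \<in> Nk k" "r \<in> Nk k" "p \<le> q" "q \<le> r" "emb r \<le> pdeg x"
  shows "(pmor x (p, q), pmor x (q, r)) \<in> composable \<Lambda>"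
    "cmp \<Lambda> (pmor x (p, q)) (pmor x (q, r)) = pmor x (p, r)"
proof -
  have "emb q \<le> pdeg x" using assms emb_le_trans by blast
  then show "(pmor x (p, q), pmor x (q, r)) \<in> composable \<Lambda>"
    using assms by (simp add: composable_def path_mor)
  show "cmp \<Lambda> (pmor x (p, q)) (pmor x (q, r)) = pmor x (p, r)"
  proof -
    have "\<forall>p\<in>Nk k. \<forall>q\<in>Nk k. \<forall>r\<in>Nk k. p \<le> q \<and> q \<le> r \<and> emb r \<le> pdeg x \<longrightarrow>
        pmor x (p, r) = cmp \<Lambda> (pmor x (p, q)) (pmor x (q, r))"
      using assms(1) unfolding path_space_iff by (elim conjE)
    from bspec[OF bspec[OF bspec[OF this assms(2)] assms(3)] assms(4)] show ?thesis
      using assms(5-7) by simp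
  qed
qed

section \<open>Paths as coherent families of initial segments\<close>

lemma path_prefix_of:
  assumes "x \<in> path_space k \<Lambda>" "p \<in> Nk k" "q \<in> Nk k" "r \<in> Nk k" "p \<le> q" "q \<le> r" "emb r \<le> pdeg x"
  shows "prefix_of (pmor x (p, q)) (pmor x (p, r))"
  using path_cmp[OF assms] by (rule prefix_ofI)

text \<open>The initial segments x(0,q) determine everything: x(q) is the source of x(0,q), and
  x(p,q) is recovered from x(0,p)x(p,q) = x(0,q) by unique factorization.\<close>

lemma path_eqI:
  assumes x: "x \<in> path_space k \<Lambda>" and y: "y \<in> path_space k \<Lambda>" and d: "pdeg x = pdeg y"
    and eq: "\<And>q. q \<in> Nk k \<Longrightarrow> emb q \<le> pdeg x \<Longrightarrow> pmor x (0, q) = pmor y (0, q)"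
  shows "x = y"
proof (rule path.equality)
  show "pobj x = pobj y"
  proof (rule extensionalityI)
    show "pobj x \<in> extensional {p \<in> Nk k. emb p \<le> pdeg x}"
      using x by (simp add: path_space_iff)
    show "pobj y \<in> extensional {p \<in> Nk k. emb p \<le> pdeg x}"
      using y by (simp add: path_space_iff d)
    fix p assume "p \<in> {p \<in> Nk k. emb p \<le> pdeg x}"
    then show "pobj x p = pobj y p"
      using path_mor(3)[OF x, of 0 p] path_mor(3)[OF y, of 0 p] eq[of p] d by simp
  qed
  show "pmor x = pmor y"
  proof (rule extensionalityI)
    let ?S = "{(p, q). p \<in> Nk k \<and> q \<in> Nk k \<and> p \<le> q \<and> emb q \<le> pdeg x}"
    show "pmor x \<in> extensional ?S"
      using x by (simp add: path_space_iff)
    show "pmor y \<in> extensional ?S"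
      using y by (simp add: path_space_iff d)
    fix z assume "z \<in> ?S"
    then obtain p q where z: "z = (p, q)" and pq: "p \<in> Nk k" "q \<in> Nk k" "p \<le> q" "emb q \<le> pdeg x"
      by auto
    have p: "emb p \<le> pdeg x" using pq emb_le_trans by blast
    show "pmor x z = pmor y z"
      using factorization_unique[OF path_cmp(1)[OF x, of 0 p q] path_cmp(1)[OF y, of 0 p q]]
        path_cmp(2)[OF x, of 0 p q] path_cmp(2)[OF y, of 0 p q] eq[of p] eq[of q] pq p d
      by (simp add: z)
  qed
qed (use d in auto)

text \<open>Counterpart of \<open>path_eqI\<close>: any family of morphisms, one for each degree up
  to \<open>M\<close> and increasing for the prefix order, is the family of initial segments of a
  path.\<close>

lemma coherent_path_exists:
  assumes M: "M \<in> Nk_inf k"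
    and h: "\<And>q. q \<in> Nk k \<Longrightarrow> emb q \<le> M \<Longrightarrow> h q \<in> mor \<Lambda> \<and> deg \<Lambda> (h q) = q"
    and pre: "\<And>p q. p \<in> Nk k \<Longrightarrow> q \<in> Nk k \<Longrightarrow> p \<le> q \<Longrightarrow> emb q \<le> M \<Longrightarrow> prefix_of (h p) (h q)"
  obtains y where "y \<in> path_space k \<Lambda>" "pdeg y = M"
    "\<And>q. q \<in> Nk k \<Longrightarrow> emb q \<le> M \<Longrightarrow> pmor y (0, q) = h q"
proof -
  \<comment> \<open>The tail of \<open>h q\<close> after \<open>h p\<close>, which will be the
    segment from \<open>p\<close> to \<open>q\<close>.\<close>
  define t where "t p q = (SOME t. (h p, t) \<in> composable \<Lambda> \<and> cmp \<Lambda> (h p) t = h q)" for p q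
  have t: "(h p, t p q) \<in> composable \<Lambda>" "cmp \<Lambda> (h p) (t p q) = h q"
    if "p \<in> Nk k" "q \<in> Nk k" "p \<le> q" "emb q \<le> M" for p q
  proof -
    have "\<exists>t. (h p, t) \<in> composable \<Lambda> \<and> cmp \<Lambda> (h p) t = h q"
      using pre[OF that] by (simp add: prefix_of_def)
    from someI_ex[OF this]
    show "(h p, t p q) \<in> composable \<Lambda>" "cmp \<Lambda> (h p) (t p q) = h q"
      by (simp_all add: t_def)
  qed
  have t': "t p q \<in> mor \<Lambda>" "rng \<Lambda> (t p q) = src \<Lambda> (h p)" "src \<Lambda> (t p q) = src \<Lambda> (h q)"
    "deg \<Lambda> (t p q) = q - p"
    if "p \<in> Nk k" "q \<in> Nk k" "p \<le> q" "emb q \<le> M" for p q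
  proof -
    have "emb p \<le> M" using that emb_le_trans by blast
    then have "p + deg \<Lambda> (t p q) = q"
      using deg_cmp[OF t(1)[OF that]] h that t(2)[OF that] by simp
    then show "deg \<Lambda> (t p q) = q - p" using fun_add_diff_left by metis
    show "src \<Lambda> (t p q) = src \<Lambda> (h q)"
      using src_cmp[OF t(1)[OF that]] t(2)[OF that] by simp
    show "t p q \<in> mor \<Lambda>" "rng \<Lambda> (t p q) = src \<Lambda> (h p)"
      using composableD[OF t(1)[OF that]] by simp_all
  qed
  have t_refl: "t p p = ident \<Lambda> (src \<Lambda> (h p))" if "p \<in> Nk k" "emb p \<le> M" for p
    using factorization_unique[OF t(1)[of p p], of "h p" "ident \<Lambda> (src \<Lambda> (h p))"] t(2)[of p p] h that
    by (simp add: composable_def)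
  \<comment> \<open>Both sides complete \<open>h p\<close> to \<open>h r\<close>, so
    \<open>h p\<close> can be cancelled on the left.\<close>
  have t_trans: "t p r = cmp \<Lambda> (t p q) (t q r)"
    if "p \<in> Nk k" "q \<in> Nk k" "r \<in> Nk k" "p \<le> q" "q \<le> r" "emb r \<le> M" for p q r
  proof -
    have q: "emb q \<le> M" and pr: "p \<le> r" using that emb_le_trans by (blast, auto)
    have c: "(t p q, t q r) \<in> composable \<Lambda>"
      using t' that q by (simp add: composable_def)
    have "cmp \<Lambda> (h p) (cmp \<Lambda> (t p q) (t q r)) = cmp \<Lambda> (h p) (t p r)"
      using cmp_assoc[OF t(1)[of p q] c] t(2) that q pr by simp
    moreover have "(h p, cmp \<Lambda> (t p q) (t q r)) \<in> composable \<Lambda>"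
      using t(1)[of p q] cmp_props[OF c] that q by (auto simp: composable_def)
    ultimately show ?thesis
      using factorization_unique t(1)[of p r] that pr by metis
  qed
  \<comment> \<open>\<open>restrict\<close> supplies the value \<open>undefined\<close> off the
    index sets, as the extensionality in \<open>path_space\<close> requires.\<close>
  define y where "y = \<lparr>pdeg = M, pobj = restrict (\<lambda>p. src \<Lambda> (h p)) {p \<in> Nk k. emb p \<le> M},
    pmor = restrict (\<lambda>(p, q). t p q) {(p, q). p \<in> Nk k \<and> q \<in> Nk k \<and> p \<le> q \<and> emb q \<le> M}\<rparr>"
  show thesis
  proof
    show "y \<in> path_space k \<Lambda>"
      unfolding path_space_iff
    proof (intro conjI ballI impI; (elim conjE)?)
      fix p assume "p \<in> Nk k" "emb p \<le> pdeg y"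
      then show "pobj y p \<in> ob \<Lambda>" "pmor y (p, p) = ident \<Lambda> (pobj y p)"
        using h t_refl by (auto simp: y_def)
    next
      fix p q assume pq: "p \<in> Nk k" "q \<in> Nk k" "p \<le> q" "emb q \<le> pdeg y"
      then have "emb p \<le> pdeg y" using emb_le_trans by blast
      with pq show "pmor y (p, q) \<in> mor \<Lambda>" "rng \<Lambda> (pmor y (p, q)) = pobj y p"
        "src \<Lambda> (pmor y (p, q)) = pobj y q" "deg \<Lambda> (pmor y (p, q)) = q - p"
        using t' by (simp_all add: y_def)
    next
      fix p q r assume pqr: "p \<in> Nk k" "q \<in> Nk k" "r \<in> Nk k" "p \<le> q" "q \<le> r" "emb r \<le> pdeg y"
      then have "emb q \<le> pdeg y" "p \<le> r" using emb_le_trans by (blast, auto)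
      with pqr show "pmor y (p, r) = cmp \<Lambda> (pmor y (p, q)) (pmor y (q, r))"
        using t_trans[OF pqr(1-5)] by (simp add: y_def)
    qed (use M in \<open>simp_all add: y_def\<close>)
    show "pdeg y = M" by (simp add: y_def)
    fix q assume q: "q \<in> Nk k" "emb q \<le> M"
    \<comment> \<open>A morphism of degree 0 is an identity, so the tail of \<open>h q\<close> after
      \<open>h 0\<close> is \<open>h q\<close> itself.\<close>
    have h0: "h 0 \<in> mor \<Lambda>" "deg \<Lambda> (h 0) = 0" using h by auto
    then have "src \<Lambda> (h 0) = rng \<Lambda> (h 0)"
      using deg_zero_ident src_ident rng_ob by metis
    then have "t 0 q = cmp \<Lambda> (h 0) (t 0 q)"
      using deg_zero_ident[OF h0] ident_cmp[of "t 0 q"] t'[of 0 q] q by simp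
    then show "pmor y (0, q) = h q"
      using t(2)[of 0 q] q by (simp add: y_def)
  qed
qed

section \<open>Shifts of paths\<close>

lemma pdeg_shift [simp]: "pdeg (shift k m x) = pdeg x - emb m"
  by (simp add: shift_def Let_def)

lemma pobj_shift [simp]:
  "p \<in> Nk k \<Longrightarrow> emb p \<le> pdeg x - emb m \<Longrightarrow> pobj (shift k m x) p = pobj x (m + p)"
  by (simp add: shift_def Let_def Omega_def)

lemma pmor_shift [simp]:
  "p \<in> Nk k \<Longrightarrow> q \<in> Nk k \<Longrightarrow> p \<le> q \<Longrightarrow> emb q \<le> pdeg x - emb m \<Longrightarrow>
    pmor (shift k m x) (p, q) = pmor x (m + p, m + q)"
  by (simp add: shift_def Let_def Omega_def)

lemma shift_path_space:
  assumes x: "x \<in> path_space k \<Lambda>" and m: "m \<in> Nk k" "emb m \<le> pdeg x"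
  shows "shift k m x \<in> path_space k \<Lambda>"
  unfolding path_space_iff
proof (intro conjI ballI impI; (elim conjE)?)
  have "pdeg x \<in> Nk_inf k" using x by (simp add: path_space_iff)
  then show "pdeg (shift k m x) \<in> Nk_inf k"
    using m by (auto simp: Nk_inf_def Nk_def emb_def zero_enat_def)
  show "pobj (shift k m x) \<in> extensional {p \<in> Nk k. emb p \<le> pdeg (shift k m x)}"
    by (simp add: shift_def Let_def Omega_def)
  show "pmor (shift k m x) \<in>
      extensional {(p, q). p \<in> Nk k \<and> q \<in> Nk k \<and> p \<le> q \<and> emb q \<le> pdeg (shift k m x)}"
    by (simp add: shift_def Let_def Omega_def)
next
  fix p assume "p \<in> Nk k" "emb p \<le> pdeg (shift k m x)"
  then show "pobj (shift k m x) p \<in> ob \<Lambda>" "pmor (shift k m x) (p, p) = ident \<Lambda> (pobj (shift k m x) p)"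
    using path_ob[OF x, of "m + p"] m by (simp_all add: emb_add_le_iff)
next
  fix p q assume pq: "p \<in> Nk k" "q \<in> Nk k" "p \<le> q" "emb q \<le> pdeg (shift k m x)"
  then have "emb p \<le> pdeg (shift k m x)" using emb_le_trans by blast
  with pq show "pmor (shift k m x) (p, q) \<in> mor \<Lambda>"
    "rng \<Lambda> (pmor (shift k m x) (p, q)) = pobj (shift k m x) p"
    "src \<Lambda> (pmor (shift k m x) (p, q)) = pobj (shift k m x) q"
    "deg \<Lambda> (pmor (shift k m x) (p, q)) = q - p"
    using path_mor[OF x, of "m + p" "m + q"] m by (simp_all add: emb_add_le_iff)
next
  fix p q r assume pqr: "p \<in> Nk k" "q \<in> Nk k" "r \<in> Nk k" "p \<le> q" "q \<le> r" "emb r \<le> pdeg (shift k m x)"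
  then have "emb q \<le> pdeg (shift k m x)" "p \<le> r" using emb_le_trans by (blast, auto)
  with pqr show "pmor (shift k m x) (p, r) = cmp \<Lambda> (pmor (shift k m x) (p, q)) (pmor (shift k m x) (q, r))"
    using path_cmp[OF x, of "m + p" "m + q" "m + r"] m by (simp add: emb_add_le_iff)
qed

text \<open>Justifies the \<open>THE\<close> in \<open>prepend\<close>. The segment of degree
  \<open>q\<close> has to be the prefix of that degree of l x(0,r) for any sufficiently large
  \<open>r\<close>; this gives both existence and uniqueness, also when \<open>q\<close> is not
  comparable with the degree of \<open>l\<close>.\<close>

lemma prepend_ex1:
  assumes l: "l \<in> mor \<Lambda>" and x: "x \<in> path_space k \<Lambda>" and sl: "src \<Lambda> l = prange x"
  shows "\<exists>!y. y \<in> path_space k \<Lambda> \<and> pdeg y = emb (deg \<Lambda> l) + pdeg x \<and>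
     pmor y (0, deg \<Lambda> l) = l \<and> shift k (deg \<Lambda> l) y = x"
proof -
  let ?d = "deg \<Lambda> l" and ?M = "emb (deg \<Lambda> l) + pdeg x"
  define c where "c q = cmp \<Lambda> l (pmor x (0, q))" for q
  have d: "?d \<in> Nk k" using l by simp
  have lx: "(l, pmor x (0, q)) \<in> composable \<Lambda>" if "q \<in> Nk k" "emb q \<le> pdeg x" for q
    using path_mor[OF x, of 0 q] that l sl by (simp add: composable_def prange_def)
  have c: "c q \<in> mor \<Lambda>" "deg \<Lambda> (c q) = ?d + q" "prefix_of l (c q)"
    if "q \<in> Nk k" "emb q \<le> pdeg x" for q
    using cmp_props[OF lx[OF that]] path_mor[OF x, of 0 q] that prefix_ofI[OF lx[OF that]]
    by (simp_all add: c_def)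
  have c_mono: "prefix_of (c p) (c q)" if pq: "p \<in> Nk k" "q \<in> Nk k" "p \<le> q" "emb q \<le> pdeg x" for p q
  proof -
    have p: "emb p \<le> pdeg x" using pq emb_le_trans by blast
    note xc = path_cmp[OF x _ pq(1,2) _ pq(3,4), of 0, simplified]
    show ?thesis
    proof (rule prefix_ofI)
      show "(c p, pmor x (p, q)) \<in> composable \<Lambda>"
        using cmp_props[OF lx[OF pq(1) p]] composableD[OF xc(1)] by (simp add: c_def composable_def)
      show "cmp \<Lambda> (c p) (pmor x (p, q)) = c q"
        using cmp_assoc[OF lx[OF pq(1) p] xc(1)] xc(2) by (simp add: c_def)
    qed
  qed
  \<comment> \<open>The least amount of \<open>x\<close> needed after \<open>l\<close> to reach past
    \<open>q\<close>.\<close>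
  define r where "r q = sup q ?d - ?d" for q
  have r: "r q \<in> Nk k" "emb (r q) \<le> pdeg x" "q \<le> ?d + r q" if "q \<in> Nk k" "emb q \<le> ?M" for q
    using that d emb_sup_diff_le by (auto simp: r_def fun_add_diff)
  have r_mono: "p \<le> q \<Longrightarrow> r p \<le> r q" for p q
    by (auto simp: r_def le_fun_def sup_nat_def intro!: diff_le_mono max.mono)
  define h where "h q = (SOME g. prefix_of g (c (r q)) \<and> deg \<Lambda> g = q)" for q
  have h: "prefix_of (h q) (c (r q))" "deg \<Lambda> (h q) = q" if "q \<in> Nk k" "emb q \<le> ?M" for q
  proof -
    have "\<exists>g. prefix_of g (c (r q)) \<and> deg \<Lambda> g = q"
      using prefix_of_exists[of "c (r q)" q] c[OF r(1,2)[OF that]] r[OF that] that by simp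
    from someI_ex[OF this] show "prefix_of (h q) (c (r q))" "deg \<Lambda> (h q) = q"
      by (simp_all add: h_def)
  qed
  have "?M \<in> Nk_inf k"
    using d x by (auto simp: path_space_iff Nk_inf_def Nk_def emb_def zero_enat_def)
  then obtain y where y: "y \<in> path_space k \<Lambda>" "pdeg y = ?M"
    and yh: "\<And>q. q \<in> Nk k \<Longrightarrow> emb q \<le> ?M \<Longrightarrow> pmor y (0, q) = h q"
  proof (rule coherent_path_exists[of _ h])
    fix q assume "q \<in> Nk k" "emb q \<le> ?M"
    then show "h q \<in> mor \<Lambda> \<and> deg \<Lambda> (h q) = q"
      using h prefix_of_mor by blast
  next
    fix p q assume pq: "p \<in> Nk k" "q \<in> Nk k" "p \<le> q" "emb q \<le> ?M"
    then have p: "emb p \<le> ?M" using emb_le_trans by blast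
    have "prefix_of (h p) (c (r q))"
      using h(1)[OF pq(1) p] c_mono[OF r(1)[OF pq(1) p] r(1)[OF pq(2,4)] r_mono[OF pq(3)] r(2)[OF pq(2,4)]]
      by (rule prefix_of_trans)
    then show "prefix_of (h p) (h q)"
      using prefix_of_comparable[OF _ h(1)[OF pq(2,4)]] h(2) pq p by simp
  qed blast
  have dq: "emb (?d + q) \<le> ?M" if "emb q \<le> pdeg x" for q
    using that by (simp add: emb_add_le_iff)
  \<comment> \<open>Both are prefixes of the same morphism and have the same degree.\<close>
  have hd: "h ?d = l"
    using prefix_of_unique[OF h(1)[of ?d] c(3)[OF r(1,2)[of ?d]]] h(2)[of ?d] d by simp
  show ?thesis
  proof (rule ex1I[of _ y], intro conjI)
    show "pmor y (0, ?d) = l" using yh[of ?d] hd d by simp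
    show "shift k ?d y = x"
    proof (rule path_eqI)
      show "shift k ?d y \<in> path_space k \<Lambda>"
        by (rule shift_path_space) (use y d in auto)
      show "pdeg (shift k ?d y) = pdeg x" using y by simp
      fix q assume "q \<in> Nk k" "emb q \<le> pdeg (shift k ?d y)"
      then have q: "q \<in> Nk k" "emb q \<le> pdeg x" using y by simp_all
      \<comment> \<open>Hence \<open>h (?d + q)\<close> is a prefix of \<open>c q\<close> of full
        degree, that is, \<open>c q\<close> itself; cancelling \<open>l\<close> then gives the
        segment of \<open>x\<close>.\<close>
      have rq: "r (?d + q) = q" by (auto simp: r_def fun_eq_iff sup_nat_def)
      have "h (?d + q) = c q"
        using prefix_of_unique[OF h(1)[of "?d + q"] prefix_of_refl] c[OF q] dq[OF q(2)] h(2)[of "?d + q"] d q(1)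
        by (simp add: rq)
      moreover have "cmp \<Lambda> l (pmor y (?d, ?d + q)) = h (?d + q)"
        "(l, pmor y (?d, ?d + q)) \<in> composable \<Lambda>"
        using path_cmp[OF y(1), of 0 ?d "?d + q"] yh[of ?d] yh[of "?d + q"] hd d q dq[OF q(2)] y(2) by simp_all
      ultimately have "pmor y (?d, ?d + q) = pmor x (0, q)"
        using factorization_unique[OF _ lx[OF q]] by (simp add: c_def)
      then show "pmor (shift k ?d y) (0, q) = pmor x (0, q)"
        using q y(2) by simp
    qed (use x in auto)
  next
    fix z assume z: "z \<in> path_space k \<Lambda> \<and> pdeg z = ?M \<and> pmor z (0, ?d) = l \<and> shift k ?d z = x"
    show "z = y"
    proof (rule path_eqI)
      fix q assume "q \<in> Nk k" "emb q \<le> pdeg z"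
      then have q: "q \<in> Nk k" "emb q \<le> ?M" using z by simp_all
      note rq = r[OF q]
      \<comment> \<open>Any candidate \<open>z\<close> has \<open>c (r q)\<close> as an initial
        segment, so its segment of degree \<open>q\<close> is the prefix that defines
        \<open>h q\<close>.\<close>
      have "pmor x (0, r q) = pmor z (?d, ?d + r q)"
        using z rq pmor_shift[of 0 "r q" z ?d] by auto
      then have "c (r q) = pmor z (0, ?d + r q)"
        using path_cmp(2)[of z 0 ?d "?d + r q"] z d rq dq[OF rq(2)] by (simp add: c_def)
      then have "prefix_of (pmor z (0, q)) (c (r q))"
        using path_prefix_of[of z 0 q "?d + r q"] z d rq q dq[OF rq(2)] by simp
      then show "pmor z (0, q) = pmor y (0, q)"
        using prefix_of_unique[OF _ h(1)[OF q]] h(2)[OF q] yh[OF q] path_mor(4)[of z 0 q] z q by simp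
    qed (use y z in auto)
  qed (use y in auto)
qed

lemma prepend_props:
  assumes "l \<in> mor \<Lambda>" "x \<in> path_space k \<Lambda>" "src \<Lambda> l = prange x"
  shows "prepend k \<Lambda> l x \<in> path_space k \<Lambda>" "pdeg (prepend k \<Lambda> l x) = emb (deg \<Lambda> l) + pdeg x"
    "shift k (deg \<Lambda> l) (prepend k \<Lambda> l x) = x"
  using theI'[OF prepend_ex1[OF assms]] by (simp_all add: prepend_def)

subsection \<open>Compact exhaustive sets\<close>

lemma openin_of_degree: "openin (mor_top \<Lambda>) (of_degree \<Lambda> m)"
  and closedin_of_degree: "closedin (mor_top \<Lambda>) (of_degree \<Lambda> m)"
proof -
  \<comment> \<open>Intersecting with \<open>Nk k\<close> keeps the set inside the discrete
    codomain; for \<open>m\<close> outside \<open>Nk k\<close> both sides are empty.\<close>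
  have eq: "of_degree \<Lambda> m = {f \<in> topspace (mor_top \<Lambda>). deg \<Lambda> f \<in> {m} \<inter> Nk k}"
    using deg_Nk by (auto simp: of_degree_def topspace_mor)
  show "openin (mor_top \<Lambda>) (of_degree \<Lambda> m)"
    unfolding eq by (rule openin_continuous_map_preimage[OF continuous_deg]) simp
  show "closedin (mor_top \<Lambda>) (of_degree \<Lambda> m)"
    unfolding eq by (rule closedin_continuous_map_preimage[OF continuous_deg]) simp
qed

lemma paths_with_range_iff:
  assumes "V \<subseteq> ob \<Lambda>"
  shows "f \<in> paths_with_range \<Lambda> V \<longleftrightarrow> f \<in> mor \<Lambda> \<and> rng \<Lambda> f \<in> V"
proof
  assume "f \<in> paths_with_range \<Lambda> V"
  then obtain v g where v: "v \<in> V" "g \<in> mor \<Lambda>" "src \<Lambda> (ident \<Lambda> v) = rng \<Lambda> g" "f = cmp \<Lambda> (ident \<Lambda> v) g"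
    by (auto simp: paths_with_range_def set_cmp_def)
  then have "rng \<Lambda> g = v" using assms src_ident by auto
  with v show "f \<in> mor \<Lambda> \<and> rng \<Lambda> f \<in> V" by auto
next
  assume f: "f \<in> mor \<Lambda> \<and> rng \<Lambda> f \<in> V"
  then have "f = cmp \<Lambda> (ident \<Lambda> (rng \<Lambda> f)) f" "src \<Lambda> (ident \<Lambda> (rng \<Lambda> f)) = rng \<Lambda> f" by simp_all
  with f show "f \<in> paths_with_range \<Lambda> V"
    unfolding paths_with_range_def set_cmp_def by blast
qed

text \<open>On \<open>\<Lambda>\<^sup>a \<times> \<Lambda>\<^sup>b\<close> composition is a continuous open bijection onto \<open>\<Lambda>\<^sup>a\<^sup>+\<^sup>b\<close>, so factorization is
  continuous.\<close>

lemma compactin_second_factors: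
  assumes ab: "a \<in> Nk k" "b \<in> Nk k"
    and K: "compactin (mor_top \<Lambda>) K" "K \<subseteq> of_degree \<Lambda> (a + b)"
  shows "compactin (mor_top \<Lambda>)
    {h. \<exists>g. (g, h) \<in> composable \<Lambda> \<and> deg \<Lambda> g = a \<and> deg \<Lambda> h = b \<and> cmp \<Lambda> g h \<in> K}"
    (is "compactin _ ?H")
proof -
  let ?P = "prod_topology (mor_top \<Lambda>) (mor_top \<Lambda>)" and ?\<phi> = "\<lambda>(f, g). cmp \<Lambda> f g"
  define S where "S = composable \<Lambda> \<inter> of_degree \<Lambda> a \<times> of_degree \<Lambda> b"
  let ?T = "subtopology ?P S" and ?Y = "subtopology (mor_top \<Lambda>) (of_degree \<Lambda> (a + b))"
  have T: "?T = subtopology (subtopology ?P (composable \<Lambda>)) S"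
    by (simp add: subtopology_subtopology S_def Int_assoc[symmetric])
  have S: "(g, h) \<in> S \<longleftrightarrow> (g, h) \<in> composable \<Lambda> \<and> deg \<Lambda> g = a \<and> deg \<Lambda> h = b" for g h
    by (auto simp: S_def of_degree_def dest: composableD)
  have S_mor: "S \<subseteq> mor \<Lambda> \<times> mor \<Lambda>"
    by (auto simp: S_def of_degree_def)
  have topT: "topspace ?T = S"
    using S_mor by (auto simp: topspace_mor)
  have into: "?\<phi> ` S \<subseteq> of_degree \<Lambda> (a + b)"
    using cmp_props by (auto simp: S of_degree_def)
  \<comment> \<open>\<open>S\<close> is open among the composable pairs because degree components
    are open, so composition stays an open map on \<open>S\<close>.\<close>
  have "openin (subtopology ?P (composable \<Lambda>)) S"
    unfolding S_def
    by (rule openin_subtopology_Int2) (simp add: openin_prod_Times_iff openin_of_degree)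
  then have op: "open_map ?T (mor_top \<Lambda>) ?\<phi>"
    unfolding T by (rule open_map_from_subtopology[OF open_cmp])
  have "homeomorphic_map ?T ?Y ?\<phi>"
  proof (rule bijective_open_imp_homeomorphic_map)
    have "continuous_map ?T (mor_top \<Lambda>) ?\<phi>"
      unfolding T by (rule continuous_map_from_subtopology[OF continuous_cmp])
    then show "continuous_map ?T ?Y ?\<phi>"
      using into by (simp only: continuous_map_in_subtopology topT image_subset_iff_funcset)
    show "open_map ?T ?Y ?\<phi>"
      by (rule open_map_into_subtopology[OF op]) (use into topT in blast)
    have "of_degree \<Lambda> (a + b) \<subseteq> ?\<phi> ` S"
    proof
      fix f assume "f \<in> of_degree \<Lambda> (a + b)"
      then have f: "f \<in> mor \<Lambda>" "deg \<Lambda> f = a + b" by (auto simp: of_degree_def)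
      obtain g h where "(g, h) \<in> composable \<Lambda>" "cmp \<Lambda> g h = f" "deg \<Lambda> g = a" "deg \<Lambda> h = deg \<Lambda> f - a"
        by (rule factorization_exists[OF f(1) ab(1)]) (use f in auto)
      then have "(g, h) \<in> S" "f = ?\<phi> (g, h)" using f by (simp_all add: S)
      then show "f \<in> ?\<phi> ` S" by (rule rev_image_eqI)
    qed
    then show "?\<phi> ` topspace ?T = topspace ?Y"
      using into topT by (auto simp: topspace_mor of_degree_def)
    show "inj_on ?\<phi> (topspace ?T)"
      unfolding topT by (rule inj_onI) (use factorization_unique in \<open>auto simp: S\<close>)
  qed
  then obtain \<psi> where "homeomorphic_maps ?T ?Y ?\<phi> \<psi>"
    using homeomorphic_map_maps by blast
  then have \<psi>: "continuous_map ?Y ?T \<psi>" "\<And>z. z \<in> S \<Longrightarrow> \<psi> (?\<phi> z) = z"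
    "\<And>f. f \<in> topspace ?Y \<Longrightarrow> ?\<phi> (\<psi> f) = f"
    unfolding homeomorphic_maps_def topT by blast+
  have "compactin ?Y K" using K by (simp add: compactin_subtopology)
  then have "compactin ?P (\<psi> ` K)"
    using image_compactin[OF _ \<psi>(1)] by (auto simp: compactin_subtopology)
  then have "compactin (mor_top \<Lambda>) (snd ` \<psi> ` K)"
    by (rule image_compactin) (rule continuous_map_snd)
  moreover have "snd ` \<psi> ` K = ?H"
  proof
    show "snd ` \<psi> ` K \<subseteq> ?H"
    proof
      fix h assume "h \<in> snd ` \<psi> ` K"
      then obtain f where f: "f \<in> K" and h: "h = snd (\<psi> f)" by blast
      have fY: "f \<in> topspace ?Y" using K f by (auto simp: topspace_mor of_degree_def)
      then have "\<psi> f \<in> S"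
        using continuous_map_image_subset_topspace[OF \<psi>(1)] topT by blast
      then show "h \<in> ?H"
        using \<psi>(3)[OF fY] f h by (cases "\<psi> f") (auto simp: S)
    qed
    show "?H \<subseteq> snd ` \<psi> ` K"
    proof safe
      fix h g assume gh: "(g, h) \<in> composable \<Lambda>" "cmp \<Lambda> g h \<in> K" "a = deg \<Lambda> g" "b = deg \<Lambda> h"
      then have "\<psi> (cmp \<Lambda> g h) = (g, h)" using \<psi>(2)[of "(g, h)"] by (simp add: S)
      then show "h \<in> snd ` \<psi> ` K" using gh by (force simp: image_image)
    qed
  qed
  ultimately show ?thesis by simp
qed

text \<open>For each degree \<open>q\<close> occurring in \<open>E\<close>, compact alignment makes
  the set of minimal common extensions compact, and continuity of factorization passes this on to
  the second factors \<alpha>. Only finitely many \<open>q\<close> occur.\<close>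

lemma compactin_min_ext:
  assumes ca: "compactly_aligned k \<Lambda>" and a: "a \<in> Nk k"
    and U: "compactin (mor_top \<Lambda>) U" "U \<subseteq> of_degree \<Lambda> a" and E: "compactin (mor_top \<Lambda>) E"
  shows "compactin (mor_top \<Lambda>) {\<alpha>. \<exists>\<xi>\<in>U. \<exists>g\<in>E. \<exists>\<beta>. (\<alpha>, \<beta>) \<in> min_ext \<Lambda> \<xi> g}"
    (is "compactin _ ?F")
proof -
  \<comment> \<open>The morphisms \<xi>\<alpha> = g\<beta> of degree \<open>sup a q\<close> with
    \<xi> in \<open>U\<close> and g in the degree \<open>q\<close> part of \<open>E\<close>: the set
    in the definition of compact alignment.\<close>
  define K where "K q = set_cmp \<Lambda> U (of_degree \<Lambda> (sup a q - a)) \<inter>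
    set_cmp \<Lambda> (of_degree \<Lambda> q \<inter> E) (of_degree \<Lambda> (sup a q - q))" for q
  define H where "H q = {h. \<exists>g. (g, h) \<in> composable \<Lambda> \<and> deg \<Lambda> g = a \<and> deg \<Lambda> h = sup a q - a \<and>
    cmp \<Lambda> g h \<in> K q}" for q
  have sup_eq: "a + (sup a q - a) = sup a q" "q + (sup a q - q) = sup a q" for q
    by (rule fun_add_diff; simp)+
  have E_mor: "E \<subseteq> mor \<Lambda>"
    using compactin_subset_topspace[OF E] by (simp add: topspace_mor)
  have H: "compactin (mor_top \<Lambda>) (H q)" if "q \<in> deg \<Lambda> ` E" for q
  proof -
    have q: "q \<in> Nk k" using that E_mor by auto
    have "compactin (mor_top \<Lambda>) (of_degree \<Lambda> q \<inter> E)"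
      by (rule closed_Int_compactin[OF closedin_of_degree E])
    then have "compactin (mor_top \<Lambda>) (K q)"
      using ca U a q unfolding compactly_aligned_def K_def by blast
    moreover have "K q \<subseteq> of_degree \<Lambda> (a + (sup a q - a))"
    proof
      fix f assume "f \<in> K q"
      then obtain \<xi> h where "\<xi> \<in> U" "h \<in> of_degree \<Lambda> (sup a q - a)" "src \<Lambda> \<xi> = rng \<Lambda> h"
        "f = cmp \<Lambda> \<xi> h"
        unfolding K_def set_cmp_def by blast
      moreover from this have "(\<xi>, h) \<in> composable \<Lambda>"
        using U by (auto simp: composable_def of_degree_def)
      ultimately show "f \<in> of_degree \<Lambda> (a + (sup a q - a))"
        using cmp_props[of \<xi> h] U by (auto simp: of_degree_def)
    qed
    ultimately show ?thesis
      unfolding H_def by (intro compactin_second_factors) (use a q in auto)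
  qed
  have "?F = (\<Union>q\<in>deg \<Lambda> ` E. H q)"
  proof safe
    fix \<alpha> \<beta> \<xi> g assume \<xi>: "\<xi> \<in> U" and g: "g \<in> E" and m: "(\<alpha>, \<beta>) \<in> min_ext \<Lambda> \<xi> g"
    have d\<xi>: "deg \<Lambda> \<xi> = a" using U \<xi> by (auto simp: of_degree_def)
    have c: "(\<xi>, \<alpha>) \<in> composable \<Lambda>" "(g, \<beta>) \<in> composable \<Lambda>" "cmp \<Lambda> \<xi> \<alpha> = cmp \<Lambda> g \<beta>"
      "deg \<Lambda> (cmp \<Lambda> \<xi> \<alpha>) = sup a (deg \<Lambda> g)"
      using m d\<xi> by (auto simp: min_ext_def)
    have "a + deg \<Lambda> \<alpha> = sup a (deg \<Lambda> g)" "deg \<Lambda> g + deg \<Lambda> \<beta> = sup a (deg \<Lambda> g)"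
      using deg_cmp[OF c(1)] deg_cmp[OF c(2)] c(3,4) d\<xi> by simp_all
    then have d: "deg \<Lambda> \<alpha> = sup a (deg \<Lambda> g) - a" "deg \<Lambda> \<beta> = sup a (deg \<Lambda> g) - deg \<Lambda> g"
      by (metis fun_add_diff_left)+
    have "cmp \<Lambda> \<xi> \<alpha> \<in> set_cmp \<Lambda> U (of_degree \<Lambda> (sup a (deg \<Lambda> g) - a))"
      using \<xi> d composableD[OF c(1)] unfolding set_cmp_def of_degree_def by blast
    moreover have "cmp \<Lambda> g \<beta> \<in> set_cmp \<Lambda> (of_degree \<Lambda> (deg \<Lambda> g) \<inter> E) (of_degree \<Lambda> (sup a (deg \<Lambda> g) - deg \<Lambda> g))"
      using g d composableD[OF c(2)] unfolding set_cmp_def of_degree_def by blast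
    ultimately have "cmp \<Lambda> \<xi> \<alpha> \<in> K (deg \<Lambda> g)"
      using c(3) by (simp add: K_def)
    then have "\<alpha> \<in> H (deg \<Lambda> g)"
      unfolding H_def using c(1) d\<xi> d(1) by blast
    then show "\<alpha> \<in> (\<Union>q\<in>deg \<Lambda> ` E. H q)" using g by blast
  next
    fix \<alpha> e assume "\<alpha> \<in> H (deg \<Lambda> e)"
    then obtain \<xi> where \<xi>: "(\<xi>, \<alpha>) \<in> composable \<Lambda>" "deg \<Lambda> \<xi> = a" "cmp \<Lambda> \<xi> \<alpha> \<in> K (deg \<Lambda> e)"
      by (auto simp: H_def)
    \<comment> \<open>So far only the degree of \<open>\<xi>\<close> is known. Unique factorization
      will identify it with \<open>\<xi>'\<close>, which lies in \<open>U\<close>.\<close>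
    obtain \<xi>' \<alpha>' where \<xi>': "\<xi>' \<in> U" "\<alpha>' \<in> mor \<Lambda>" "src \<Lambda> \<xi>' = rng \<Lambda> \<alpha>'" "cmp \<Lambda> \<xi> \<alpha> = cmp \<Lambda> \<xi>' \<alpha>'"
      using \<xi>(3) unfolding K_def set_cmp_def of_degree_def by blast
    obtain g \<beta> where g: "g \<in> E" "g \<in> mor \<Lambda>" "deg \<Lambda> g = deg \<Lambda> e" "\<beta> \<in> of_degree \<Lambda> (sup a (deg \<Lambda> e) - deg \<Lambda> e)"
      "src \<Lambda> g = rng \<Lambda> \<beta>" "cmp \<Lambda> \<xi> \<alpha> = cmp \<Lambda> g \<beta>"
      using \<xi>(3) unfolding K_def set_cmp_def of_degree_def by blast
    have c': "(\<xi>', \<alpha>') \<in> composable \<Lambda>" "(g, \<beta>) \<in> composable \<Lambda>"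
      using \<xi>' g U by (auto simp: composable_def of_degree_def)
    have "deg \<Lambda> \<xi>' = a" using \<xi>' U by (auto simp: of_degree_def)
    then have "\<xi> \<in> U"
      using factorization_unique[OF \<xi>(1) c'(1)] \<xi>' \<xi>(2) by simp
    moreover have "(\<alpha>, \<beta>) \<in> min_ext \<Lambda> \<xi> g"
      using \<xi> g c' deg_cmp[OF c'(2)] sup_eq by (simp add: min_ext_def of_degree_def)
    ultimately show "\<exists>\<xi>\<in>U. \<exists>g\<in>E. \<exists>\<beta>. (\<alpha>, \<beta>) \<in> min_ext \<Lambda> \<xi> g"
      using g(1) by blast
  qed
  \<comment> \<open>The continuous image of a compact set in a discrete space is finite.\<close>
  moreover have "finite (deg \<Lambda> ` E)"
    using image_compactin[OF E continuous_deg] by (simp add: compactin_discrete_topology)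
  then have "compactin (mor_top \<Lambda>) (\<Union>q\<in>deg \<Lambda> ` E. H q)"
    by (intro compactin_Union) (use H in auto)
  ultimately show ?thesis by simp
qed

text \<open>Transfers exhaustiveness from \<open>E\<close> to the set of the \<alpha>. A minimal
  common extension w = \<xi>fs = gt has a prefix of degree d(\<xi>) \<or> d(g), which factors as
  \<xi>\<alpha> = g\<beta>; cancelling \<xi> from w leaves a common extension of f and
  \<alpha>.\<close>

lemma min_ext_residual:
  assumes f: "f \<in> mor \<Lambda>" "\<xi> \<in> mor \<Lambda>" "src \<Lambda> \<xi> = rng \<Lambda> f"
    and ne: "min_ext \<Lambda> (cmp \<Lambda> \<xi> f) g \<noteq> {}"
  obtains \<alpha> \<beta> where "(\<alpha>, \<beta>) \<in> min_ext \<Lambda> \<xi> g" "min_ext \<Lambda> f \<alpha> \<noteq> {}"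
proof -
  have \<xi>f: "(\<xi>, f) \<in> composable \<Lambda>" using f by (simp add: composable_def)
  obtain s t where c: "(cmp \<Lambda> \<xi> f, s) \<in> composable \<Lambda>" "(g, t) \<in> composable \<Lambda>"
    "cmp \<Lambda> (cmp \<Lambda> \<xi> f) s = cmp \<Lambda> g t"
    and dw: "deg \<Lambda> (cmp \<Lambda> (cmp \<Lambda> \<xi> f) s) = sup (deg \<Lambda> (cmp \<Lambda> \<xi> f)) (deg \<Lambda> g)"
    using ne by (auto simp: min_ext_def)
  define w where "w = cmp \<Lambda> g t"
  have fs: "(f, s) \<in> composable \<Lambda>"
    using c(1) f src_cmp[OF \<xi>f] by (auto simp: composable_def)
  have \<xi>w: "(\<xi>, cmp \<Lambda> f s) \<in> composable \<Lambda>" "cmp \<Lambda> \<xi> (cmp \<Lambda> f s) = w"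
    using cmp_props[OF fs] f cmp_assoc[OF \<xi>f fs] c by (auto simp: composable_def w_def)
  have w: "w \<in> mor \<Lambda>" "deg \<Lambda> w = sup (deg \<Lambda> \<xi> + deg \<Lambda> f) (deg \<Lambda> g)"
    using cmp_mor[OF c(2)] dw deg_cmp[OF \<xi>f] c(3) by (simp_all add: w_def)
  have pre: "prefix_of \<xi> w" "prefix_of g w"
    using prefix_ofI[OF \<xi>w] prefix_ofI[OF c(2)] w_def by auto
  let ?n = "sup (deg \<Lambda> \<xi>) (deg \<Lambda> g)"
  obtain e where e: "prefix_of e w" "deg \<Lambda> e = ?n"
    using prefix_of_exists[of w ?n] w f composableD[OF c(2)] prefix_of_mor[OF pre(1)] prefix_of_mor[OF pre(2)]
    by auto
  obtain \<alpha> where \<alpha>: "(\<xi>, \<alpha>) \<in> composable \<Lambda>" "cmp \<Lambda> \<xi> \<alpha> = e"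
    using prefix_of_comparable[OF pre(1) e(1)] e(2) by (auto simp: prefix_of_def)
  obtain \<beta> where \<beta>: "(g, \<beta>) \<in> composable \<Lambda>" "cmp \<Lambda> g \<beta> = e"
    using prefix_of_comparable[OF pre(2) e(1)] e(2) by (auto simp: prefix_of_def)
  obtain \<tau> where \<tau>: "(e, \<tau>) \<in> composable \<Lambda>" "cmp \<Lambda> e \<tau> = w"
    using e(1) by (auto simp: prefix_of_def)
  have \<alpha>\<tau>: "(\<alpha>, \<tau>) \<in> composable \<Lambda>"
    using \<alpha> \<tau>(1) src_cmp[OF \<alpha>(1)] by (auto simp: composable_def)
  have "(\<xi>, cmp \<Lambda> \<alpha> \<tau>) \<in> composable \<Lambda>"
    using cmp_props[OF \<alpha>\<tau>] \<alpha>(1) by (auto simp: composable_def)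
  moreover have "cmp \<Lambda> \<xi> (cmp \<Lambda> \<alpha> \<tau>) = w"
    using cmp_assoc[OF \<alpha>(1) \<alpha>\<tau>] \<alpha>(2) \<tau>(2) by simp
  ultimately have eq: "cmp \<Lambda> f s = cmp \<Lambda> \<alpha> \<tau>"
    using factorization_unique \<xi>w by metis
  have "deg \<Lambda> \<xi> + deg \<Lambda> (cmp \<Lambda> f s) = sup (deg \<Lambda> \<xi> + deg \<Lambda> f) (deg \<Lambda> g)"
    "deg \<Lambda> \<xi> + deg \<Lambda> \<alpha> = ?n"
    using deg_cmp[OF \<xi>w(1)] \<xi>w(2) w(2) deg_cmp[OF \<alpha>(1)] \<alpha>(2) e(2) by simp_all
  \<comment> \<open>Minimality: adding d(\<xi>) commutes with maxima, and (d(\<xi>) + d(f)) \<or>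
    d(\<xi>) \<or> d(g) is (d(\<xi>) + d(f)) \<or> d(g).\<close>
  then have "deg \<Lambda> (cmp \<Lambda> f s) i = sup (deg \<Lambda> f) (deg \<Lambda> \<alpha>) i" for i
    by (auto dest!: fun_cong[of _ _ i] simp: sup_nat_def)
  then have "(s, \<tau>) \<in> min_ext \<Lambda> f \<alpha>"
    using fs \<alpha>\<tau> eq by (auto simp: min_ext_def fun_eq_iff)
  moreover have "(\<alpha>, \<beta>) \<in> min_ext \<Lambda> \<xi> g"
    using \<alpha> \<beta> e(2) by (simp add: min_ext_def)
  ultimately show thesis using that by blast
qed

text \<open>The neighbourhood \<open>U\<close> of \<open>\<mu>\<close> below is chosen so small that \<open>s\<close> is injective on it: this is what lets
  one recover \<open>\<mu>\<close> itself from an element of \<open>F\<close> with range \<open>s(\<mu>)\<close>.\<close>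

lemma CE_extension:
  assumes ca: "compactly_aligned k \<Lambda>" and \<mu>: "\<mu> \<in> mor \<Lambda>" and E: "E \<in> CE \<Lambda> (rng \<Lambda> \<mu>)"
  obtains F where "F \<in> CE \<Lambda> (src \<Lambda> \<mu>)"
    "\<And>\<alpha>. \<alpha> \<in> F \<Longrightarrow> rng \<Lambda> \<alpha> = src \<Lambda> \<mu> \<Longrightarrow> \<exists>g\<in>E. \<exists>\<beta>. (\<alpha>, \<beta>) \<in> min_ext \<Lambda> \<mu> g"
proof -
  obtain V where Ec: "compactin (mor_top \<Lambda>) E" and V: "openin (ob_top \<Lambda>) V" "rng \<Lambda> \<mu> \<in> V" "V \<subseteq> rng \<Lambda> ` E"
    and Ex: "exhaustive \<Lambda> (rng \<Lambda> ` E) E"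
    using E by (auto simp: CE_def)
  have rE: "rng \<Lambda> ` E \<subseteq> ob \<Lambda>" using Ex by (simp add: exhaustive_def)
  obtain W0 where W0: "openin (mor_top \<Lambda>) W0" "\<mu> \<in> W0" "openin (ob_top \<Lambda>) (src \<Lambda> ` W0)"
    "homeomorphic_map (subtopology (mor_top \<Lambda>) W0) (subtopology (ob_top \<Lambda>) (src \<Lambda> ` W0)) (src \<Lambda>)"
    using local_homeo_src \<mu> unfolding local_homeomorphism_map_def topspace_mor by blast
  have W0m: "W0 \<subseteq> mor \<Lambda>" using openin_subset[OF W0(1)] by (simp add: topspace_mor)
  have inj: "inj_on (src \<Lambda>) W0"
    using homeomorphic_imp_injective_map[OF W0(4)] W0m by (simp add: topspace_mor Int_absorb1)
  \<comment> \<open>\<open>W0\<close> makes the source map injective, the fixed degree lets compact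
    alignment apply, and ranges in \<open>V\<close> are ranges at which \<open>E\<close> is
    exhaustive.\<close>
  define W where "W = W0 \<inter> of_degree \<Lambda> (deg \<Lambda> \<mu>) \<inter> {f \<in> topspace (mor_top \<Lambda>). rng \<Lambda> f \<in> V}"
  have "openin (mor_top \<Lambda>) W"
    unfolding W_def
    by (intro openin_Int W0(1) openin_of_degree openin_continuous_map_preimage[OF continuous_rng V(1)])
  moreover have "\<mu> \<in> W" using W0 \<mu> V by (auto simp: W_def of_degree_def topspace_mor)
  moreover have "neighbourhood_base_of (compactin (mor_top \<Lambda>)) (mor_top \<Lambda>)"
    using locally_compact_space_neighbourhood_base Hausdorff_mor locally_compact_mor by blast
  ultimately obtain O' U where O': "openin (mor_top \<Lambda>) O'" "\<mu> \<in> O'" "O' \<subseteq> U"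
    and U: "compactin (mor_top \<Lambda>) U" "U \<subseteq> W"
    unfolding neighbourhood_base_of by meson
  have Um: "\<xi> \<in> mor \<Lambda>" "rng \<Lambda> \<xi> \<in> V" "\<xi> \<in> W0" if "\<xi> \<in> U" for \<xi>
    using that U(2) by (auto simp: W_def topspace_mor)
  \<comment> \<open>This open set will witness that the ranges of \<open>F\<close> form a
    neighbourhood of the source of \<open>\<mu>\<close>.\<close>
  have srcO: "openin (ob_top \<Lambda>) (src \<Lambda> ` O')"
  proof -
    have "O' \<subseteq> W0" using O'(3) Um by blast
    then have "openin (subtopology (mor_top \<Lambda>) W0) O'"
      using O'(1) W0(1) by (simp add: openin_open_subtopology)
    then have "openin (subtopology (ob_top \<Lambda>) (src \<Lambda> ` W0)) (src \<Lambda> ` O')"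
      using homeomorphic_imp_open_map[OF W0(4)] by (simp add: open_map_def)
    then show ?thesis using W0(3) by (simp add: openin_open_subtopology)
  qed
  define F where "F = {\<alpha>. \<exists>\<xi>\<in>U. \<exists>g\<in>E. \<exists>\<beta>. (\<alpha>, \<beta>) \<in> min_ext \<Lambda> \<xi> g}"
  have F_mor: "F \<subseteq> mor \<Lambda>"
    by (auto simp: F_def min_ext_def dest: composableD)
  have F_rng: "\<exists>\<xi>\<in>U. src \<Lambda> \<xi> = rng \<Lambda> \<alpha> \<and> (\<exists>g\<in>E. \<exists>\<beta>. (\<alpha>, \<beta>) \<in> min_ext \<Lambda> \<xi> g)" if "\<alpha> \<in> F" for \<alpha>
    using that unfolding F_def min_ext_def by (blast dest: composableD(3))
  \<comment> \<open>Exhaustiveness of \<open>E\<close>, tested on \<xi>f, gives that of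
    \<open>F\<close>, tested on f. The case of an identity f shows that every source of an element
    of \<open>U\<close> is a range of \<open>F\<close>.\<close>
  have F_res: "\<exists>\<alpha>\<in>F. rng \<Lambda> \<alpha> = src \<Lambda> \<xi> \<and> min_ext \<Lambda> f \<alpha> \<noteq> {}"
    if \<xi>: "\<xi> \<in> U" and f: "f \<in> mor \<Lambda>" "rng \<Lambda> f = src \<Lambda> \<xi>" for \<xi> f
  proof -
    have c: "(\<xi>, f) \<in> composable \<Lambda>" using Um[OF \<xi>] f by (simp add: composable_def)
    have "cmp \<Lambda> \<xi> f \<in> paths_with_range \<Lambda> (rng \<Lambda> ` E)"
      using paths_with_range_iff[OF rE] cmp_props[OF c] Um[OF \<xi>] V(3) by auto
    then obtain g where g: "g \<in> E" "min_ext \<Lambda> (cmp \<Lambda> \<xi> f) g \<noteq> {}"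
      using Ex unfolding exhaustive_def by blast
    obtain \<alpha> \<beta> where \<alpha>: "(\<alpha>, \<beta>) \<in> min_ext \<Lambda> \<xi> g" "min_ext \<Lambda> f \<alpha> \<noteq> {}"
      using min_ext_residual[OF f(1) Um(1)[OF \<xi>] f(2)[symmetric] g(2)] .
    then have "rng \<Lambda> \<alpha> = src \<Lambda> \<xi>" by (auto simp: min_ext_def composable_def)
    moreover have "\<alpha> \<in> F" using \<alpha>(1) \<xi> g(1) unfolding F_def by blast
    ultimately show ?thesis using \<alpha>(2) by blast
  qed
  have rF: "rng \<Lambda> ` F = src \<Lambda> ` U"
  proof
    show "rng \<Lambda> ` F \<subseteq> src \<Lambda> ` U" using F_rng by force
    show "src \<Lambda> ` U \<subseteq> rng \<Lambda> ` F"
    proof safe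
      fix \<xi> assume \<xi>: "\<xi> \<in> U"
      show "src \<Lambda> \<xi> \<in> rng \<Lambda> ` F"
        using F_res[OF \<xi>, of "ident \<Lambda> (src \<Lambda> \<xi>)"] Um[OF \<xi>] by force
    qed
  qed
  have rFo: "rng \<Lambda> ` F \<subseteq> ob \<Lambda>" using F_mor by auto
  show thesis
  proof
    have "compactin (mor_top \<Lambda>) F"
      unfolding F_def by (rule compactin_min_ext[OF ca _ U(1) _ Ec]) (use \<mu> U(2) W_def in auto)
    moreover have "src \<Lambda> \<mu> \<in> src \<Lambda> ` O'" "src \<Lambda> ` O' \<subseteq> rng \<Lambda> ` F"
      using O' rF by auto
    moreover have "exhaustive \<Lambda> (rng \<Lambda> ` F) F"
      unfolding exhaustive_def
    proof (intro conjI ballI rFo)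
      show "F \<subseteq> paths_with_range \<Lambda> (rng \<Lambda> ` F)"
        using paths_with_range_iff[OF rFo] F_mor by blast
      fix f assume "f \<in> paths_with_range \<Lambda> (rng \<Lambda> ` F)"
      then have "f \<in> mor \<Lambda>" "rng \<Lambda> f \<in> src \<Lambda> ` U"
        using paths_with_range_iff[OF rFo] rF by auto
      then show "\<exists>\<alpha>\<in>F. min_ext \<Lambda> f \<alpha> \<noteq> {}" using F_res by blast
    qed
    ultimately show "F \<in> CE \<Lambda> (src \<Lambda> \<mu>)"
      unfolding CE_def using srcO by blast
    fix \<alpha> assume \<alpha>: "\<alpha> \<in> F" "rng \<Lambda> \<alpha> = src \<Lambda> \<mu>"
    obtain \<xi> where \<xi>: "\<xi> \<in> U" "src \<Lambda> \<xi> = src \<Lambda> \<mu>" "\<exists>g\<in>E. \<exists>\<beta>. (\<alpha>, \<beta>) \<in> min_ext \<Lambda> \<xi> g"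
      using F_rng[OF \<alpha>(1)] \<alpha>(2) by auto
    have "\<xi> = \<mu>" using inj_onD[OF inj \<xi>(2)] Um(3)[OF \<xi>(1)] W0(2) by blast
    then show "\<exists>g\<in>E. \<exists>\<beta>. (\<alpha>, \<beta>) \<in> min_ext \<Lambda> \<mu> g" using \<xi>(3) by simp
  qed
qed

subsection \<open>Boundary paths\<close>

lemma boundary_pathsD:
  assumes "x \<in> boundary_paths k \<Lambda>" "m \<in> Nk k" "emb m \<le> pdeg x" "E \<in> CE \<Lambda> (pobj x m)"
  obtains f where "f \<in> E" "emb (m + deg \<Lambda> f) \<le> pdeg x" "pmor x (m, m + deg \<Lambda> f) = f"
  using assms unfolding boundary_paths_def by blast

lemma boundary_paths_shift_iff:
  assumes ca: "compactly_aligned k \<Lambda>"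
    and y: "y \<in> path_space k \<Lambda>" and d: "d \<in> Nk k" "emb d \<le> pdeg y"
  shows "shift k d y \<in> boundary_paths k \<Lambda> \<longleftrightarrow> y \<in> boundary_paths k \<Lambda>"
proof
  assume yb: "y \<in> boundary_paths k \<Lambda>"
  show "shift k d y \<in> boundary_paths k \<Lambda>"
    unfolding boundary_paths_def
  proof (intro CollectI conjI ballI impI shift_path_space y d)
    fix m E assume m: "m \<in> Nk k" "emb m \<le> pdeg (shift k d y)" and E: "E \<in> CE \<Lambda> (pobj (shift k d y) m)"
    \<comment> \<open>The vertex of the shifted path at \<open>m\<close> is that of \<open>y\<close>
      at \<open>d + m\<close>, so this direction only specializes the boundary condition.\<close>
    have "emb (d + m) \<le> pdeg y" "E \<in> CE \<Lambda> (pobj y (d + m))"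
      using m E d by (simp_all add: emb_add_le_iff)
    then obtain f where f: "f \<in> E" "emb (d + m + deg \<Lambda> f) \<le> pdeg y"
      "pmor y (d + m, d + m + deg \<Lambda> f) = f"
      using boundary_pathsD[OF yb] m(1) d(1) by (metis Nk_add)
    have fm: "f \<in> mor \<Lambda>"
      using E f(1) compactin_subset_topspace topspace_mor unfolding CE_def by blast
    have le: "emb (m + deg \<Lambda> f) \<le> pdeg y - emb d"
      using f(2) d by (simp add: emb_add_le_iff add.assoc)
    show "\<exists>f\<in>E. emb (m + deg \<Lambda> f) \<le> pdeg (shift k d y) \<and>
        pmor (shift k d y) (m, m + deg \<Lambda> f) = f"
      using f le m fm by (intro bexI[of _ f]) (simp_all add: add.assoc)
  qed
next
  assume sb: "shift k d y \<in> boundary_paths k \<Lambda>"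
  show "y \<in> boundary_paths k \<Lambda>"
    unfolding boundary_paths_def
  proof (intro CollectI conjI ballI impI y)
    fix n E assume n: "n \<in> Nk k" "emb n \<le> pdeg y" and E: "E \<in> CE \<Lambda> (pobj y n)"
    \<comment> \<open>The shifted path may miss the vertex at \<open>n\<close>, but it contains the
      one at \<open>p\<close>, as its vertex at \<open>p - d\<close>.\<close>
    define p where "p = sup n d"
    have p: "p \<in> Nk k" "emb p \<le> pdeg y" "n \<le> p" "d \<le> p"
      using n d by (auto simp: p_def emb_le_sup)
    define \<mu> where "\<mu> = pmor y (n, p)"
    have \<mu>: "\<mu> \<in> mor \<Lambda>" "rng \<Lambda> \<mu> = pobj y n" "src \<Lambda> \<mu> = pobj y p" "deg \<Lambda> \<mu> = p - n"
      unfolding \<mu>_def using path_mor[OF y n(1) p(1,3,2)] by simp_all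
    have "E \<in> CE \<Lambda> (rng \<Lambda> \<mu>)" using E \<mu> by simp
    from CE_extension[OF ca \<mu>(1) this] obtain F where F: "F \<in> CE \<Lambda> (pobj y p)"
      "\<And>\<alpha>. \<alpha> \<in> F \<Longrightarrow> rng \<Lambda> \<alpha> = pobj y p \<Longrightarrow> \<exists>g\<in>E. \<exists>\<beta>. (\<alpha>, \<beta>) \<in> min_ext \<Lambda> \<mu> g"
      unfolding \<mu>(3) by blast
    have dp: "d + (p - d) = p" by (rule fun_add_diff[OF p(4)])
    have le: "emb (p - d) \<le> pdeg y - emb d" using emb_add_le_iff[OF d(2), of "p - d"] dp p(2) by simp
    have "F \<in> CE \<Lambda> (pobj (shift k d y) (p - d))"
      using F(1) le p(1) dp by simp
    from boundary_pathsD[OF sb _ _ this] obtain \<alpha>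
      where \<alpha>: "\<alpha> \<in> F" "emb (p - d + deg \<Lambda> \<alpha>) \<le> pdeg y - emb d"
      "pmor (shift k d y) (p - d, p - d + deg \<Lambda> \<alpha>) = \<alpha>"
      using le p(1) by auto
    have \<alpha>m: "\<alpha> \<in> mor \<Lambda>"
      using F(1) \<alpha>(1) compactin_subset_topspace topspace_mor unfolding CE_def by blast
    have dpa: "d + (p - d + deg \<Lambda> \<alpha>) = p + deg \<Lambda> \<alpha>" using dp by (metis add.assoc)
    have le': "emb (p + deg \<Lambda> \<alpha>) \<le> pdeg y"
      using emb_add_le_iff[OF d(2), of "p - d + deg \<Lambda> \<alpha>"] \<alpha>(2) dpa by simp
    have \<alpha>y: "pmor y (p, p + deg \<Lambda> \<alpha>) = \<alpha>"
      using pmor_shift[of "p - d" "p - d + deg \<Lambda> \<alpha>" y d] \<alpha> \<alpha>m p(1) dp dpa by simp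
    \<comment> \<open>\<open>F\<close> also contains morphisms with other ranges; only this range
      links \<alpha> to \<open>\<mu>\<close> itself.\<close>
    have "rng \<Lambda> \<alpha> = pobj y p"
      using path_mor(2)[OF y p(1) _ _ le'] \<alpha>y \<alpha>m p(1) by simp
    then obtain g \<beta> where g: "g \<in> E" "(\<alpha>, \<beta>) \<in> min_ext \<Lambda> \<mu> g" using F(2)[OF \<alpha>(1)] by blast
    let ?q = "p + deg \<Lambda> \<alpha>"
    have nq: "n \<le> ?q" using p(3) by (auto simp: le_fun_def intro: trans_le_add1)
    have "cmp \<Lambda> \<mu> \<alpha> = pmor y (n, ?q)"
      using path_cmp(2)[OF y n(1) p(1) _ p(3) _ le'] \<alpha>y \<alpha>m p(1) by (simp add: \<mu>_def)
    then have pre: "prefix_of g (pmor y (n, ?q))"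
      using g(2) by (auto simp: min_ext_def prefix_of_def)
    have gm: "g \<in> mor \<Lambda>" "deg \<Lambda> g \<le> ?q - n"
      using prefix_of_mor[OF pre] path_mor(4)[OF y n(1) _ nq le'] \<alpha>m p(1) by simp_all
    have ngq: "n + deg \<Lambda> g \<le> ?q"
      using fun_add_le_cancel[of n "deg \<Lambda> g" "?q - n"] gm(2) fun_add_diff[OF nq] by simp
    have ng: "emb (n + deg \<Lambda> g) \<le> pdeg y" using ngq le' by (rule emb_le_trans)
    \<comment> \<open>Both this segment of \<open>y\<close> and \<open>g\<close> are prefixes of
      y(n, p + d(\<alpha>)) = \<mu>\<alpha> = g\<beta>, of equal degree, hence equal.\<close>
    have "prefix_of (pmor y (n, n + deg \<Lambda> g)) (pmor y (n, ?q))"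
      by (rule path_prefix_of[OF y n(1) _ _ _ ngq le']) (use n gm \<alpha>m p(1) in auto)
    moreover have "deg \<Lambda> (pmor y (n, n + deg \<Lambda> g)) = deg \<Lambda> g"
      using path_mor(4)[OF y n(1) _ _ ng] n gm by simp
    ultimately have "pmor y (n, n + deg \<Lambda> g) = g" using prefix_of_unique[OF _ pre] by simp
    then show "\<exists>f\<in>E. emb (n + deg \<Lambda> f) \<le> pdeg y \<and> pmor y (n, n + deg \<Lambda> f) = f"
      using g(1) ng by blast
  qed
qed

text \<open>Shifting the concatenated path by the degree of \<open>l\<close> returns
  \<open>x\<close>, so this is the shift equivalence applied to that path.\<close>

lemma boundary_paths_prepend_iff:
  assumes ca: "compactly_aligned k \<Lambda>"
    and l: "l \<in> mor \<Lambda>" and x: "x \<in> path_space k \<Lambda>" and sl: "src \<Lambda> l = prange x"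
  shows "prepend k \<Lambda> l x \<in> boundary_paths k \<Lambda> \<longleftrightarrow> x \<in> boundary_paths k \<Lambda>"
  using boundary_paths_shift_iff[OF ca prepend_props(1)[OF l x sl], of "deg \<Lambda> l"]
    prepend_props(2,3)[OF l x sl] l by simp

end

theorem proposition4p7:
  fixes k :: nat and \<Lambda> :: "('o, 'a) kgraph"
  assumes "topological_kgraph k \<Lambda>"
    and "compactly_aligned k \<Lambda>"
  shows "(\<forall>x\<in>boundary_paths k \<Lambda>. \<forall>m\<in>Nk k. \<forall>l\<in>mor \<Lambda>.
            emb m \<le> pdeg x \<and> src \<Lambda> l = prange x \<longrightarrow>
            shift k m x \<in> boundary_paths k \<Lambda> \<and> prepend k \<Lambda> l x \<in> boundary_paths k \<Lambda>) \<and>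
         invariant_subset (path_groupoid k \<Lambda>) (boundary_paths k \<Lambda>)"
proof -
  interpret top_kgraph k \<Lambda> by standard (rule assms(1))
  have sub: "boundary_paths k \<Lambda> \<subseteq> path_space k \<Lambda>" by (auto simp: boundary_paths_def)
  show ?thesis
  proof (intro conjI ballI impI; (elim conjE)?)
    fix x m l assume x: "x \<in> boundary_paths k \<Lambda>" and "m \<in> Nk k" "l \<in> mor \<Lambda>"
      "emb m \<le> pdeg x" "src \<Lambda> l = prange x"
    moreover from x sub have "x \<in> path_space k \<Lambda>" by blast
    ultimately show "shift k m x \<in> boundary_paths k \<Lambda>" "prepend k \<Lambda> l x \<in> boundary_paths k \<Lambda>"
      using boundary_paths_shift_iff[OF assms(2)] boundary_paths_prepend_iff[OF assms(2)] by blast+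
  next
    \<comment> \<open>The two ends of a groupoid morphism are concatenations with one common path,
      and each is a boundary path iff that path is.\<close>
    show "invariant_subset (path_groupoid k \<Lambda>) (boundary_paths k \<Lambda>)"
      using sub boundary_paths_prepend_iff[OF assms(2)]
      by (auto simp: invariant_subset_def path_groupoid_def)
  qed
qed

end
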